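(* Let $a>0$ and $b,c\in\mathbb{R}$. Suppose that $$\mathbb{V}(m)=m(am^2+bm+c)$$ is the pseudo-variance function of the one-sided Cauchy-Stieltjes kernel family $\mathcal{K}_+(\nu)$ generated by a non-degenerate probability measure $\nu$ on $\mathbb{R}$ with support bounded from above. Then: (1) for all $z$ in the upper half-plane $\mathbb{C}^+$, $$G_\nu(z)=\frac{b+1+2az-\sqrt{(b+1)^2+4a(z-c)}}{2(c+bz+az^2)},$$ where the square root is the branch that is positive for large real positive $z$, continued analytically; (2) $$\nu(dx)=\frac{\sqrt{4ac-(b+1)^2-4ax}}{2\pi(c+bx+ax^2)}\mathbf{1}_{(-\infty,\,c-(b+1)^2/(4a))}(x)\,dx+p(a,b,c)\,\delta_{-(b+\sqrt{b^2-4ac})/(2a)},$$ where $p(a,b,c)=1-1/\sqrt{b^2-4ac}$ if $b^2>4ac+1$, and $p(a,b,c)=0$ otherwise (in which case the atomic term is absent); (3) the domain of means of $\mathcal{K}_+(\nu)$ is $(-\infty,m_+)$ with $$m_+=\begin{cases}-\dfrac{1+b}{2a}&\text{if } c>0 \text{ and } -\sqrt{1+4ac}\le b\le 2\sqrt{ac}-1,\\[2mm] -\dfrac{b+\sqrt{b^2-4ac}}{2a}&\text{if } c>0\text{ and } b\le-\sqrt{1+4ac},\\[2mm] -\dfrac{b+1+\sqrt{(b+1)^2-4ac}}{2a}&\text{if either } c\le0,\text{ or } c>0 \text{ and } b>2\sqrt{ac}-1;\end{cases}$$ (4) $\nu$ is freely infinitely divisible (infinitely divisible with respect to free additive convolution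 $\boxplus$) and does not have a finite first moment.
   Context: Non-degenerate means: not a point mass. $G_\nu(z)=\int\frac{1}{z-x}\nu(dx)$ is the Cauchy transform. One-sided Cauchy-Stieltjes kernel family: let $B(\nu)=\max\{0,\sup\operatorname{supp}(\nu)\}<\infty$ and $\theta_+=1/B(\nu)$ (with $1/0=\infty$). For $0<\theta<\theta_+$ let $M(\theta)=\int\frac{1}{1-\theta x}\nu(dx)$ and $P_\theta(dx)=\frac{1}{M(\theta)(1-\theta x)}\nu(dx)$; then $\mathcal{K}_+(\nu)=\{P_\theta:0<\theta<\theta_+\}$. The mean $m(\theta)=\int xP_\theta(dx)$ is finite and is a strictly increasing continuous function on $(0,\theta_+)$; the domain of means $(m_0,m_+)$ is the image of $(0,\theta_+)$ under $m(\cdot)$, and $\psi:(m_0,m_+)\to(0,\theta_+)$ is the inverse function of $m(\cdot)$. The pseudo-variance function of $\mathcal{K}_+(\nu)$ is $\mathbb{V}(m)=m\left(\frac{1}{\psi(m)}-m\right)$ for $m\in(m_0,m_+)$; the value of $\mathbb{V}(m)/m$ at $m=0$ (if $0$ is in the domain) is understood as $1/\psi(m)-m$. *)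

theory Defs
  imports "HOL-Probability.Probability"
begin

definition nondegenerate :: "real measure \<Rightarrow> bool" where
  "nondegenerate \<nu> \<longleftrightarrow> (\<forall>t. \<nu> \<noteq> return borel t)"

definition msupp :: "real measure \<Rightarrow> real set" where
  "msupp \<nu> = {x. \<forall>U. open U \<and> x \<in> U \<longrightarrow> emeasure \<nu> U > 0}"

definition cauchy_transform :: "real measure \<Rightarrow> complex \<Rightarrow> complex" where
  "cauchy_transform \<nu> z = (LINT x|\<nu>. 1 / (z - complex_of_real x))"


subsection \<open>One-sided Cauchy-Stieltjes kernel families\<close>

definition csk_B :: "real measure \<Rightarrow> real" where
  "csk_B \<nu> = max 0 (Sup (msupp \<nu>))"

(* in ereal, 1 / 0 = \<infinity> *)
definition theta_plus :: "real measure \<Rightarrow> ereal" where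
  "theta_plus \<nu> = 1 / ereal (csk_B \<nu>)"

definition csk_params :: "real measure \<Rightarrow> real set" where
  "csk_params \<nu> = {\<theta>. 0 < \<theta> \<and> ereal \<theta> < theta_plus \<nu>}"

definition csk_M :: "real measure \<Rightarrow> real \<Rightarrow> real" where
  "csk_M \<nu> \<theta> = (LINT x|\<nu>. 1 / (1 - \<theta> * x))"

definition csk_P :: "real measure \<Rightarrow> real \<Rightarrow> real measure" where
  "csk_P \<nu> \<theta> = density \<nu> (\<lambda>x. ennreal (1 / (csk_M \<nu> \<theta> * (1 - \<theta> * x))))"

definition csk_mean :: "real measure \<Rightarrow> real \<Rightarrow> real" where
  "csk_mean \<nu> \<theta> = (LINT x|csk_P \<nu> \<theta>. x)"

definition domain_of_means :: "real measure \<Rightarrow> real set" where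
  "domain_of_means \<nu> = csk_mean \<nu> ` csk_params \<nu>"

definition csk_psi :: "real measure \<Rightarrow> real \<Rightarrow> real" where
  "csk_psi \<nu> = the_inv_into (csk_params \<nu>) (csk_mean \<nu>)"

definition pseudo_variance :: "real measure \<Rightarrow> real \<Rightarrow> real" where
  "pseudo_variance \<nu> m = m * (1 / csk_psi \<nu> m - m)"


subsection \<open>Free additive convolution and free infinite divisibility\<close>

text \<open>
  For measures with possibly unbounded support, free additive convolution is described as in
  Bercovici and Voiculescu (1993). The reciprocal Cauchy transform \<open>F\<close> is injective on some
  truncated cone whose image contains another truncated cone. The Voiculescu transform is
  \<open>\<phi>(z) = F\<^sup>-\<^sup>1(z) - z\<close> there (any two choices of the cone of injectivity give the same function,
  since \<open>F(w) / w\<close> tends to \<open>1\<close> nontangentially), and free additive convolution adds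
  Voiculescu transforms. The convolution is given as a relation; its last argument is unique,
  because a Voiculescu transform determines the measure.
\<close>

definition trunc_cone :: "real \<Rightarrow> real \<Rightarrow> complex set" where
  "trunc_cone \<alpha> \<beta> = {z. Im z > \<beta> \<and> \<bar>Re z\<bar> < \<alpha> * Im z}"

definition recip_cauchy :: "real measure \<Rightarrow> complex \<Rightarrow> complex" where
  "recip_cauchy \<mu> z = 1 / cauchy_transform \<mu> z"

definition voiculescu_transform_on ::
    "real measure \<Rightarrow> real \<Rightarrow> real \<Rightarrow> (complex \<Rightarrow> complex) \<Rightarrow> bool" where
  "voiculescu_transform_on \<mu> \<alpha> \<beta> \<phi> \<longleftrightarrow>
     (\<exists>\<alpha>'>0. \<exists>\<beta>'>0.
        inj_on (recip_cauchy \<mu>) (trunc_cone \<alpha>' \<beta>') \<and>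
        trunc_cone \<alpha> \<beta> \<subseteq> recip_cauchy \<mu> ` trunc_cone \<alpha>' \<beta>' \<and>
        (\<forall>z\<in>trunc_cone \<alpha> \<beta>.
           \<phi> z = the_inv_into (trunc_cone \<alpha>' \<beta>') (recip_cauchy \<mu>) z - z))"

definition is_free_convolution :: "real measure \<Rightarrow> real measure \<Rightarrow> real measure \<Rightarrow> bool" where
  "is_free_convolution \<mu>1 \<mu>2 \<mu> \<longleftrightarrow>
     real_distribution \<mu>1 \<and> real_distribution \<mu>2 \<and> real_distribution \<mu> \<and>
     (\<exists>\<alpha>>0. \<exists>\<beta>>0. \<exists>\<phi>1 \<phi>2.
        voiculescu_transform_on \<mu>1 \<alpha> \<beta> \<phi>1 \<and>
        voiculescu_transform_on \<mu>2 \<alpha> \<beta> \<phi>2 \<and>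
        voiculescu_transform_on \<mu> \<alpha> \<beta> (\<lambda>z. \<phi>1 z + \<phi>2 z))"

(* is_free_power \<mu> n \<rho>: \<rho> is the n-fold free convolution of \<mu> with itself, n \<ge> 1 *)
inductive is_free_power :: "real measure \<Rightarrow> nat \<Rightarrow> real measure \<Rightarrow> bool" for \<mu> where
  one: "real_distribution \<mu> \<Longrightarrow> is_free_power \<mu> 1 \<mu>"
| step: "is_free_power \<mu> n \<kappa> \<Longrightarrow> is_free_convolution \<kappa> \<mu> \<rho> \<Longrightarrow> is_free_power \<mu> (Suc n) \<rho>"

definition freely_infinitely_divisible :: "real measure \<Rightarrow> bool" where
  "freely_infinitely_divisible \<nu> \<longleftrightarrow>
     (\<forall>n\<ge>1. \<exists>\<mu>. real_distribution \<mu> \<and> is_free_power \<mu> n \<nu>)"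


subsection \<open>Explicit formulas\<close>

text \<open>
  For \<open>a > 0\<close> and \<open>Im z > 0\<close> the argument of the square root lies in the upper half-plane, where
  the principal branch \<^const>\<open>csqrt\<close> is holomorphic; it is the branch that is positive on the
  positive half-line. If \<open>b\<^sup>2 < 4 a c\<close>, the denominator has one zero in the upper half-plane, which is
  a removable singularity of the quotient; the value there is a junk \<open>0\<close>.
\<close>

definition cubic_cauchy :: "real \<Rightarrow> real \<Rightarrow> real \<Rightarrow> complex \<Rightarrow> complex" where
  "cubic_cauchy a b c z =
     (of_real b + 1 + 2 * of_real a * z
        - csqrt ((of_real b + 1)\<^sup>2 + 4 * of_real a * (z - of_real c)))
     / (2 * (of_real c + of_real b * z + of_real a * z\<^sup>2))"

definition cubic_density :: "real \<Rightarrow> real \<Rightarrow> real \<Rightarrow> real \<Rightarrow> real" where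
  "cubic_density a b c x =
     sqrt (4 * a * c - (b + 1)\<^sup>2 - 4 * a * x) / (2 * pi * (c + b * x + a * x\<^sup>2))
     * indicator {..<c - (b + 1)\<^sup>2 / (4 * a)} x"

definition cubic_atom_mass :: "real \<Rightarrow> real \<Rightarrow> real \<Rightarrow> real" where
  "cubic_atom_mass a b c =
     (if b\<^sup>2 > 4 * a * c + 1 then 1 - 1 / sqrt (b\<^sup>2 - 4 * a * c) else 0)"

end

theory Submission
  imports Defs "HOL-Complex_Analysis.Complex_Analysis" "HOL-Real_Asymp.Real_Asymp"
begin

text \<open>
  For \<open>z > B(\<nu>)\<close> the mean at \<open>\<theta> = 1/z\<close> is \<open>m = z - 1/G(z)\<close>, so the hypothesis says
  \<open>z = a m\<^sup>2 + (b + 1) m + c\<close>. As \<open>m \<le> B(\<nu>)\<close>, the lower root is the right one for large \<open>z\<close>, and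
  analytic continuation off \<open>(-\<infinity>, B(\<nu>)]\<close> gives \<open>G = 4a / ((w + 1)\<^sup>2 - \<Delta>)\<close> on the upper half-plane,
  where \<open>w\<^sup>2 = (b + 1)\<^sup>2 + 4a(z - c)\<close> and \<open>\<Delta> = b\<^sup>2 - 4ac\<close>.

  Independently, substituting \<open>x = e - s\<^sup>2/(4a)\<close> (\<open>e\<close> the edge of the density) makes the explicit law
  an integral of the rational function \<open>4s\<^sup>2 / (\<pi> (s\<^sup>2 + A\<^sup>2)(s\<^sup>2 + B\<^sup>2))\<close> with
  \<open>A, B = \<bar>1 \<plusminus> \<surd>\<Delta>\<bar>\<close> (no modulus when \<open>\<Delta> < 0\<close>), and partial fractions show that it is a
  probability measure with this same \<open>G\<close>, for all parameters; the atom is the pole \<open>w = \<surd>\<Delta> - 1\<close> of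
  \<open>G\<close>, present when \<open>\<Delta> > 1\<close>. A Cauchy transform determines its measure, so \<open>\<nu>\<close> is the explicit law.
  The inverse of \<open>1/G\<close> is explicit too: the Voiculescu transform is \<open>(-b - \<surd>(\<Delta> + 4au)) / (2a)\<close>, and
  \<open>t\<close> times it belongs to the parameters \<open>(a/t\<^sup>2, b/t, c)\<close>, hence all free convolution roots exist in the family.
  Finally a finite first moment would bound \<open>m\<close> below as \<open>z \<rightarrow> \<infinity>\<close>.
\<close>

subsection \<open>Cauchy transforms determine measures\<close>

lemma cmod_diff_of_real_ge_Im: "\<bar>Im z\<bar> \<le> cmod (z - complex_of_real x)"
  using abs_Im_le_cmod[of "z - complex_of_real x"] by simp

lemma (in real_distribution) integrable_cauchy_kernel:
  assumes "Im z \<noteq> 0"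
  shows "integrable M (\<lambda>x. 1 / (z - complex_of_real x))"
proof (rule integrable_const_bound[where B="1 / \<bar>Im z\<bar>"])
  show "AE x in M. cmod (1 / (z - complex_of_real x)) \<le> 1 / \<bar>Im z\<bar>"
    using assms cmod_diff_of_real_ge_Im[of z] by (auto simp: norm_divide intro!: frac_le)
qed auto

section \<open>Smoothing by the Cauchy law, and uniqueness of the measure\<close>

definition cauchy_density :: "real \<Rightarrow> real" where
  "cauchy_density x = 1 / (pi * (1 + x\<^sup>2))"

lemma cauchy_density_pos: "cauchy_density x > 0"
  unfolding cauchy_density_def by (simp add: add_pos_nonneg)

lemma cauchy_density_measurable [measurable]: "cauchy_density \<in> borel_measurable borel"
  unfolding cauchy_density_def by measurable

lemma has_bochner_integral_cauchy_density: "has_bochner_integral lborel cauchy_density 1"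
proof -
  have "integrable lborel (\<lambda>x::real. inverse (1 + x\<^sup>2))"
    using integrable_inverse_1_plus_square by (simp add: set_integrable_def)
  moreover have "(LBINT x. inverse (1 + x\<^sup>2)) = pi"
    using LBINT_inverse_1_plus_square
    by (simp add: interval_lebesgue_integral_def set_lebesgue_integral_def)
  ultimately have "has_bochner_integral lborel (\<lambda>x. (1 / pi) * inverse (1 + x\<^sup>2)) ((1 / pi) * pi)"
    by (intro has_bochner_integral_mult_right) (auto simp: has_bochner_integral_iff)
  then show ?thesis by (simp add: cauchy_density_def[abs_def] field_simps)
qed

lemma real_distribution_cauchy: "real_distribution (density lborel cauchy_density)"
proof -
  have "prob_space (density lborel cauchy_density)"
  proof
    have "emeasure (density lborel cauchy_density) UNIV = (\<integral>\<^sup>+x. ennreal (cauchy_density x) \<partial>lborel)"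
      by (simp add: emeasure_density)
    also have "\<dots> = ennreal 1"
      using has_bochner_integral_cauchy_density cauchy_density_pos
      by (subst nn_integral_eq_integral)
        (auto simp: has_bochner_integral_iff less_imp_le)
    finally show "emeasure (density lborel cauchy_density) (space (density lborel cauchy_density)) = 1"
      by simp
  qed
  then show ?thesis
    by (simp add: real_distribution_def real_distribution_axioms_def)
qed

text \<open>The Poisson kernel of the half-plane is a dilated Cauchy density. Hence -Im G / pi at
  height \<epsilon> is the density of the measure convolved with the Cauchy law scaled by
  \<epsilon>.\<close>

lemma neg_Im_cauchy_kernel:
  assumes "\<epsilon> > 0"
  shows "- Im (1 / (Complex x \<epsilon> - complex_of_real t)) / pi = cauchy_density ((x - t) / \<epsilon>) / \<epsilon>"
proof -
  have "(x - t)\<^sup>2 + \<epsilon>\<^sup>2 > 0" using assms by (simp add: add_nonneg_pos)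
  moreover have "1 + ((x - t) / \<epsilon>)\<^sup>2 = ((x - t)\<^sup>2 + \<epsilon>\<^sup>2) / \<epsilon>\<^sup>2"
    using assms by (simp add: power_divide add_divide_distrib)
  ultimately show ?thesis using assms
    by (simp add: Im_divide cauchy_density_def power2_eq_square)
qed

text \<open>Stieltjes: \<open>- Im G(x + i\<epsilon>) / \<pi>\<close> is the density of the convolution of \<open>M\<close> with a scaled
  Cauchy law, so its Fourier transform is \<open>char M\<close> times a factor that does not depend on \<open>M\<close>.\<close>

lemma (in real_distribution) char_eq_fourier_Im_cauchy_transform:
  assumes e: "\<epsilon> > 0"
  shows "(LBINT x. iexp (s * x) * complex_of_real (- Im (cauchy_transform M (Complex x \<epsilon>)) / pi))
    = char M s * char (density lborel cauchy_density) (s * \<epsilon>)"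
proof -
  interpret P: pair_sigma_finite M lborel ..
  define f where "f t x = iexp (s * x) * complex_of_real (cauchy_density ((x - t) / \<epsilon>) / \<epsilon>)" for t x
  have f_meas [measurable]: "case_prod f \<in> borel_measurable (M \<Otimes>\<^sub>M lborel)"
    unfolding f_def by measurable
  have norm_f: "norm (f t x) = cauchy_density ((x - t) / \<epsilon>) / \<epsilon>" for t x
    unfolding f_def using e cauchy_density_pos by (simp add: norm_mult norm_divide less_imp_le abs_of_pos)
  have shift: "has_bochner_integral lborel (\<lambda>x. cauchy_density ((x - t) / \<epsilon>) / \<epsilon>) 1" for t
  proof -
    have "has_bochner_integral lborel (\<lambda>x. cauchy_density ((-t/\<epsilon>) + (1/\<epsilon>) * x)) (1 /\<^sub>R \<bar>1/\<epsilon>\<bar>)"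
      using e has_bochner_integral_cauchy_density by (subst lborel_has_bochner_integral_real_affine_iff[symmetric]) auto
    then have "has_bochner_integral lborel (\<lambda>x. cauchy_density ((-t/\<epsilon>) + (1/\<epsilon>) * x) / \<epsilon>) ((1 /\<^sub>R \<bar>1/\<epsilon>\<bar>) / \<epsilon>)"
      by (rule has_bochner_integral_divide)
    moreover have "(1 /\<^sub>R \<bar>1/\<epsilon>\<bar>) / \<epsilon> = 1" using e by simp
    ultimately show ?thesis by (simp add: diff_divide_distrib)
  qed
  \<comment> \<open>After taking norms the inner integral is 1 for every t, and \<open>M\<close> is
    finite, so Fubini applies.\<close>
  have int_f: "integrable (M \<Otimes>\<^sub>M lborel) (case_prod f)"
  proof (rule P.Fubini_integrable)
    show "integrable M (\<lambda>x. LBINT y. norm (case_prod f (x, y)))"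
      using shift by (simp add: norm_f has_bochner_integral_iff)
    show "AE x in M. integrable lborel (\<lambda>y. case_prod f (x, y))"
    proof (rule AE_I2)
      fix t
      have "integrable lborel (\<lambda>y. norm (f t y))"
        unfolding norm_f using shift by (simp add: has_bochner_integral_iff)
      moreover have "f t \<in> borel_measurable lborel" unfolding f_def by measurable
      ultimately show "integrable lborel (\<lambda>y. case_prod f (t, y))"
        by (simp add: integrable_norm_iff)
    qed
  qed simp
  have inner: "(\<integral>t. f t x \<partial>M) = iexp (s * x) * complex_of_real (- Im (cauchy_transform M (Complex x \<epsilon>)) / pi)" for x
  proof -
    have "- Im (cauchy_transform M (Complex x \<epsilon>)) / pi
        = (\<integral>t. - Im (1 / (Complex x \<epsilon> - complex_of_real t)) / pi \<partial>M)"
      unfolding cauchy_transform_def using e integrable_cauchy_kernel[of "Complex x \<epsilon>"] by simp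
    also have "\<dots> = (\<integral>t. cauchy_density ((x - t) / \<epsilon>) / \<epsilon> \<partial>M)"
      using neg_Im_cauchy_kernel[OF e] by simp
    finally show ?thesis
      unfolding f_def by (simp flip: integral_complex_of_real)
  qed
  have "(LBINT x. f t x) = iexp (s * t) * char (density lborel cauchy_density) (s * \<epsilon>)" for t
  proof -
    \<comment> \<open>The substitution x = t + \<epsilon> u splits the exponential into a factor for
      \<open>M\<close> and a factor for the Cauchy law.\<close>
    have "(LBINT x. f t x) = \<epsilon> *\<^sub>R (LBINT u. f t (t + \<epsilon> * u))"
      using lborel_integral_real_affine[of \<epsilon> "f t" t] e by simp
    also have "(\<lambda>u. f t (t + \<epsilon> * u)) = (\<lambda>u. (iexp (s * t) / \<epsilon>) * (cauchy_density u *\<^sub>R iexp (s * \<epsilon> * u)))"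
      using e by (auto simp: f_def fun_eq_iff scaleR_conv_of_real exp_add[symmetric] algebra_simps)
    also have "\<epsilon> *\<^sub>R (LBINT u. (iexp (s * t) / \<epsilon>) * (cauchy_density u *\<^sub>R iexp (s * \<epsilon> * u)))
       = iexp (s * t) * (LBINT u. (cauchy_density u *\<^sub>R iexp (s * \<epsilon> * u)))"
      using e by (simp add: scaleR_conv_of_real)
    also have "(LBINT u. (cauchy_density u *\<^sub>R iexp (s * \<epsilon> * u))) = char (density lborel cauchy_density) (s * \<epsilon>)"
      unfolding char_def using cauchy_density_pos by (subst integral_density) (auto simp: less_imp_le)
    finally show ?thesis .
  qed
  then have "(\<integral>t. (LBINT x. f t x) \<partial>M) = char M s * char (density lborel cauchy_density) (s * \<epsilon>)"
    unfolding char_def[of M] by simp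
  with P.Fubini_integral[OF int_f] inner show ?thesis by simp
qed

text \<open>For each frequency s a height \<epsilon> is chosen so small that the characteristic
  function of the Cauchy law, being continuous with value 1 at 0, does not vanish at s \<epsilon>.
  Cancelling this common factor leaves equal characteristic functions.\<close>

theorem cauchy_transform_unique:
  assumes "real_distribution \<mu>" "real_distribution \<nu>"
    and eq: "\<And>z. Im z > 0 \<Longrightarrow> cauchy_transform \<mu> z = cauchy_transform \<nu> z"
  shows "\<mu> = \<nu>"
proof (rule Levy_uniqueness[OF assms(1,2)], rule ext)
  fix s
  interpret \<mu>: real_distribution \<mu> by fact
  interpret \<nu>: real_distribution \<nu> by fact
  interpret C: real_distribution "density lborel cauchy_density" by (rule real_distribution_cauchy)
  let ?c = "char (density lborel cauchy_density)"
  have "((\<lambda>\<epsilon>. ?c (s * \<epsilon>)) \<longlongrightarrow> ?c (s * 0)) (at_right 0)"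
    by (rule isCont_tendsto_compose[OF C.isCont_char]) (auto intro!: tendsto_eq_intros)
  then have "((\<lambda>\<epsilon>. ?c (s * \<epsilon>)) \<longlongrightarrow> 1) (at_right 0)" by (simp add: C.char_zero)
  then have "\<forall>\<^sub>F \<epsilon> in at_right 0. ?c (s * \<epsilon>) \<noteq> 0" by (rule tendsto_imp_eventually_ne) simp
  with eventually_at_right_less[of "0::real"] have "\<forall>\<^sub>F \<epsilon> in at_right 0. \<epsilon> > 0 \<and> ?c (s * \<epsilon>) \<noteq> 0"
    by eventually_elim simp
  then obtain \<epsilon> where e: "\<epsilon> > 0" "?c (s * \<epsilon>) \<noteq> 0"
    using eventually_happens'[OF trivial_limit_at_right_real] by blast
  have "char \<mu> s * ?c (s * \<epsilon>) = char \<nu> s * ?c (s * \<epsilon>)"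
    unfolding \<mu>.char_eq_fourier_Im_cauchy_transform[OF e(1), symmetric]
      \<nu>.char_eq_fourier_Im_cauchy_transform[OF e(1), symmetric]
    using e(1) by (simp add: eq)
  with e(2) show "char \<mu> s = char \<nu> s" by simp
qed

subsection \<open>Rational integrals over a half-line\<close>

text \<open>The parameter s of x = e - s^2/(4a) is taken negative because this map is increasing
  there, as the substitution theorems demand.\<close>

abbreviation neg_lborel :: "real measure" where
  "neg_lborel \<equiv> restrict_space lborel {..<0}"

lemma einterval_minf: "einterval (-\<infinity>) (ereal e) = {..<e}"
  by (auto simp: einterval_def)

lemma interval_integral_minf:
  fixes f :: "real \<Rightarrow> 'a :: {banach, second_countable_topology}"
  shows
  "(LBINT x=-\<infinity>..ereal e. f x) = integral\<^sup>L (restrict_space lborel {..<e}) f"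
  by (simp add: interval_lebesgue_integral_def einterval_minf set_lebesgue_integral_def integral_restrict_space)

lemma set_integrable_minf:
  fixes f :: "real \<Rightarrow> 'a :: {banach, second_countable_topology}"
  shows "set_integrable lborel (einterval (-\<infinity>) (ereal e)) f \<longleftrightarrow> integrable (restrict_space lborel {..<e}) f"
  using integrable_restrict_space[of "{..<e}" lborel f]
  by (simp add: einterval_minf set_integrable_def)

text \<open>Since s is real, both factors of s^2 + A^2 = (A - \<i> s)(A + \<i> s) have real part Re
  A.\<close>

lemma sq_plus_sq_norm_ge:
  fixes A :: complex
  assumes "Re A > 0"
  shows "(Re A)\<^sup>2 \<le> cmod ((of_real s)\<^sup>2 + A\<^sup>2)"
proof -
  have eq: "(of_real s)\<^sup>2 + A\<^sup>2 = (A - \<i> * of_real s) * (A + \<i> * of_real s)"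
    by (simp add: algebra_simps power2_eq_square)
  have "Re A \<le> cmod (A - \<i> * of_real s)" "Re A \<le> cmod (A + \<i> * of_real s)"
    using complex_Re_le_cmod[of "A - \<i> * of_real s"] complex_Re_le_cmod[of "A + \<i> * of_real s"] by auto
  then show ?thesis
    unfolding eq norm_mult power2_eq_square[of "Re A"] using assms by (intro mult_mono) auto
qed

lemma sq_plus_sq_nonzero:
  fixes A :: complex
  assumes "Re A > 0"
  shows "(of_real s)\<^sup>2 + A\<^sup>2 \<noteq> 0"
  using sq_plus_sq_norm_ge[OF assms, of s] assms by (auto simp: power2_eq_square) (smt (verit) mult_pos_pos)

text \<open>Write 1 + s^2 as the denominator plus the constant 1 - A^2; the constant is absorbed
  because the denominator has modulus at least (Re A)^2. This supplies an integrable
  majorant.\<close>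

lemma sq_plus_sq_inverse_bound:
  fixes A :: complex
  assumes "Re A > 0"
  obtains K where "K > 0" "\<And>s. cmod (1 / ((of_real s)\<^sup>2 + A\<^sup>2)) \<le> K * inverse (1 + s\<^sup>2)"
proof
  define K where "K = 1 + cmod (1 - A\<^sup>2) / (Re A)\<^sup>2"
  show "K > 0" unfolding K_def by (simp add: add_pos_nonneg)
  fix s
  let ?q = "(of_real s)\<^sup>2 + A\<^sup>2"
  have q: "cmod ?q > 0" using sq_plus_sq_nonzero[OF assms] by simp
  have p: "1 + s\<^sup>2 > 0" by (simp add: add_pos_nonneg)
  have "1 + s\<^sup>2 = cmod (of_real (1 + s\<^sup>2))" using p by (metis abs_of_pos norm_of_real)
  also have "of_real (1 + s\<^sup>2) = ?q + (1 - A\<^sup>2)" by simp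
  also have "cmod \<dots> \<le> cmod ?q + cmod (1 - A\<^sup>2)" by (rule norm_triangle_ineq)
  also have "cmod (1 - A\<^sup>2) \<le> cmod (1 - A\<^sup>2) / (Re A)\<^sup>2 * cmod ?q"
    using mult_left_mono[OF sq_plus_sq_norm_ge[OF assms, of s], of "cmod (1 - A\<^sup>2)"] assms
    by (simp add: field_simps)
  finally have "1 + s\<^sup>2 \<le> K * cmod ?q" by (simp add: K_def algebra_simps)
  then show "cmod (1 / ?q) \<le> K * inverse (1 + s\<^sup>2)"
    using p q by (simp add: norm_divide field_simps)
qed

lemma integrable_neg_inverse_1_plus_square: "integrable neg_lborel (\<lambda>x. inverse (1 + x\<^sup>2))"
proof -
  have "set_integrable lborel UNIV (\<lambda>x::real. inverse (1 + x\<^sup>2))"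
    using integrable_inverse_1_plus_square by simp
  then have "set_integrable lborel {..<0} (\<lambda>x::real. inverse (1 + x\<^sup>2))"
    by (rule set_integrable_subset) auto
  then show ?thesis by (simp add: set_integrable_def integrable_restrict_space)
qed

lemma integrable_inverse_sq_plus_sq:
  fixes A :: complex
  assumes "Re A > 0"
  shows "integrable neg_lborel (\<lambda>s. 1 / ((of_real s)\<^sup>2 + A\<^sup>2))"
proof -
  obtain K where "K > 0" "\<And>s. cmod (1 / ((of_real s)\<^sup>2 + A\<^sup>2)) \<le> K * inverse (1 + s\<^sup>2)"
    using sq_plus_sq_inverse_bound[OF assms] by blast
  then show ?thesis
    by (intro Bochner_Integration.integrable_bound[OF
          integrable_mult_right[OF integrable_neg_inverse_1_plus_square, of K]])
       (auto intro!: measurable_restrict_space1)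
qed

section \<open>Antiderivatives and the basic integrals\<close>

text \<open>This is arctan(s/A)/A in logarithmic form. For Re A > 0 and real s both arguments stay
  in the right half-plane, away from the cut of \<open>Ln\<close>.\<close>

definition sq_plus_sq_primitive :: "complex \<Rightarrow> real \<Rightarrow> complex" where
  "sq_plus_sq_primitive A s = \<i> / (2 * A) * (Ln (A - \<i> * of_real s) - Ln (A + \<i> * of_real s))"

lemma has_vector_derivative_sq_plus_sq_primitive:
  fixes A :: complex
  assumes "Re A > 0"
  shows "(sq_plus_sq_primitive A has_vector_derivative 1 / ((of_real s)\<^sup>2 + A\<^sup>2)) (at s)"
proof -
  define H where "H z = \<i> / (2 * A) * (Ln (A - \<i> * z) - Ln (A + \<i> * z))" for z
  have n: "A - \<i> * of_real s \<notin> \<real>\<^sub>\<le>\<^sub>0" "A + \<i> * of_real s \<notin> \<real>\<^sub>\<le>\<^sub>0"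
    using assms by (auto simp: complex_nonpos_Reals_iff)
  have A0: "A \<noteq> 0" using assms by auto
  have nz: "A - \<i> * of_real s \<noteq> 0" "A + \<i> * of_real s \<noteq> 0"
    using assms by (auto simp: complex_eq_iff)
  have "(H has_field_derivative
      \<i> / (2 * A) * (inverse (A - \<i> * of_real s) * (- \<i>) - inverse (A + \<i> * of_real s) * \<i>)) (at (of_real s))"
    unfolding H_def using n A0 by (auto intro!: derivative_eq_intros)
  also have "\<i> / (2 * A) * (inverse (A - \<i> * of_real s) * (- \<i>) - inverse (A + \<i> * of_real s) * \<i>)
      = 1 / ((A - \<i> * of_real s) * (A + \<i> * of_real s))"
    using nz A0 by (simp add: divide_simps) (simp add: algebra_simps)
  also have "(A - \<i> * of_real s) * (A + \<i> * of_real s) = (of_real s)\<^sup>2 + A\<^sup>2"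
    by (simp add: algebra_simps power2_eq_square)
  finally have "((\<lambda>s. H (of_real s)) has_vector_derivative 1 / ((of_real s)\<^sup>2 + A\<^sup>2)) (at s)"
    by (rule has_vector_derivative_real_field)
  then show ?thesis by (simp add: H_def sq_plus_sq_primitive_def[abs_def])
qed

text \<open>For s < 0 the factor -s is pulled out of both logarithms and its logarithm cancels. The
  remaining arguments tend to \<i> and -\<i>, whose logarithms differ by \<i> pi.\<close>

lemma sq_plus_sq_primitive_at_bot:
  fixes A :: complex
  assumes "Re A > 0"
  shows "(sq_plus_sq_primitive A \<longlongrightarrow> - (pi / (2 * A))) at_bot"
proof -
  have A: "A \<noteq> 0" using assms by auto
  have lim0: "((\<lambda>s. A / of_real (- s)) \<longlongrightarrow> 0) at_bot"
  proof (rule tendsto_divide_0[OF tendsto_const])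
    show "filterlim (\<lambda>s. complex_of_real (- s)) at_infinity at_bot"
      by (rule filterlim_compose[OF filterlim_of_real_at_infinity]) (rule filterlim_uminus_at_top_at_bot)
  qed
  have "((\<lambda>s. \<i> / (2 * A) * (Ln (A / of_real (- s) + \<i>) - Ln (A / of_real (- s) - \<i>)))
      \<longlongrightarrow> \<i> / (2 * A) * (Ln (0 + \<i>) - Ln (0 - \<i>))) at_bot"
    by (intro tendsto_intros lim0) (auto simp: complex_nonpos_Reals_iff)
  also have "\<i> / (2 * A) * (Ln (0 + \<i>) - Ln (0 - \<i>)) = - (pi / (2 * A))"
    using A by (simp add: field_simps)
  finally show ?thesis
  proof (rule Lim_transform_eventually)
    show "\<forall>\<^sub>F s in at_bot. \<i> / (2 * A) * (Ln (A / of_real (- s) + \<i>) - Ln (A / of_real (- s) - \<i>)) = sq_plus_sq_primitive A s"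
      using eventually_gt_at_bot[of "0::real"]
    proof eventually_elim
      case (elim s)
      have nz: "A / of_real (- s) + \<i> \<noteq> 0" "A / of_real (- s) - \<i> \<noteq> 0"
        using assms elim by (auto simp: complex_eq_iff Re_divide_of_real)
      have e: "A - \<i> * of_real s = of_real (- s) * (A / of_real (- s) + \<i>)"
           "A + \<i> * of_real s = of_real (- s) * (A / of_real (- s) - \<i>)"
        using elim by (simp_all add: field_simps)
      have L: "Ln (of_real t * X) = of_real (ln t) + Ln X" if "t > 0" "X \<noteq> 0" for t X
        using that by (simp add: Ln_times_of_real Ln_of_real)
      have "Ln (A - \<i> * of_real s) = of_real (ln (- s)) + Ln (A / of_real (- s) + \<i>)"
           "Ln (A + \<i> * of_real s) = of_real (ln (- s)) + Ln (A / of_real (- s) - \<i>)"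
        unfolding e using elim by (intro L nz; simp)+
      then show ?case
        unfolding sq_plus_sq_primitive_def by simp
    qed
  qed
qed

lemma has_bochner_integral_neg_FTC:
  fixes F f :: "real \<Rightarrow> complex"
  assumes F: "\<And>s. (F has_vector_derivative f s) (at s)"
    and f: "\<And>s. isCont f s" and int: "integrable neg_lborel f"
    and lim: "(F \<longlongrightarrow> l) at_bot" and F0: "F 0 = 0"
  shows "has_bochner_integral neg_lborel f (- l)"
proof -
  have "isCont F 0" using F by (rule has_vector_derivative_continuous)
  then have "(F \<longlongrightarrow> 0) (at_left 0)"
    using F0 by (metis isCont_def filterlim_at_split)
  then have "((F \<circ> real_of_ereal) \<longlongrightarrow> 0) (at_left (ereal 0))"
    by (simp only: ereal_tendsto_simps)
  moreover have "((F \<circ> real_of_ereal) \<longlongrightarrow> l) (at_right (-\<infinity>))"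
    using lim by (simp only: ereal_tendsto_simps)
  moreover have "set_integrable lborel (einterval (-\<infinity>) (ereal 0)) f"
    using int by (simp only: set_integrable_minf)
  ultimately have "(LBINT s=-\<infinity>..ereal 0. f s) = 0 - l"
    using F f by (intro interval_integral_FTC_integrable[where F=F]) auto
  with int show ?thesis
    by (simp add: has_bochner_integral_iff interval_integral_minf)
qed

lemma has_bochner_integral_inverse_sq_plus_sq:
  fixes A :: complex
  assumes "Re A > 0"
  shows "has_bochner_integral neg_lborel (\<lambda>s. 1 / ((of_real s)\<^sup>2 + A\<^sup>2)) (pi / (2 * A))"
proof -
  have "has_bochner_integral neg_lborel (\<lambda>s. 1 / ((of_real s)\<^sup>2 + A\<^sup>2)) (- (- (pi / (2 * A))))"
    by (rule has_bochner_integral_neg_FTC[OF has_vector_derivative_sq_plus_sq_primitive[OF assms]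
          _ integrable_inverse_sq_plus_sq[OF assms] sq_plus_sq_primitive_at_bot[OF assms]])
       (use sq_plus_sq_nonzero[OF assms] in \<open>auto intro!: continuous_intros simp: sq_plus_sq_primitive_def\<close>)
  then show ?thesis by simp
qed

text \<open>The confluent case that partial fractions do not reach. It occurs for \<Delta> = 0, and
  also when the spectral variable w happens to equal A.\<close>

lemma has_bochner_integral_double_pole:
  fixes A :: complex
  assumes A: "Re A > 0"
  shows "has_bochner_integral neg_lborel
    (\<lambda>s. (of_real s)\<^sup>2 / (((of_real s)\<^sup>2 + A\<^sup>2) * ((of_real s)\<^sup>2 + A\<^sup>2))) (pi / (4 * A))"
proof -
  define f where "f s = (of_real s)\<^sup>2 / (((of_real s)\<^sup>2 + A\<^sup>2) * ((of_real s)\<^sup>2 + A\<^sup>2))" for s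
  \<comment> \<open>Integration by parts of s times s / (s^2 + A^2)^2 produces this
    antiderivative.\<close>
  define F where "F s = (sq_plus_sq_primitive A s - of_real s / ((of_real s)\<^sup>2 + A\<^sup>2)) / 2" for s
  note nz = sq_plus_sq_nonzero[OF A]
  obtain K where K: "K > 0" "\<And>s. cmod (1 / ((of_real s)\<^sup>2 + A\<^sup>2)) \<le> K * inverse (1 + s\<^sup>2)"
    using sq_plus_sq_inverse_bound[OF A] by blast
  have "((\<lambda>s. K * (\<bar>s\<bar> * inverse (1 + s\<^sup>2))) \<longlongrightarrow> 0) at_bot" by real_asymp
  then have "((\<lambda>s. of_real s / ((of_real s)\<^sup>2 + A\<^sup>2)) \<longlongrightarrow> 0) at_bot"
  proof (rule Lim_null_comparison[rotated], intro always_eventually allI)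
    fix s
    show "cmod (of_real s / ((of_real s)\<^sup>2 + A\<^sup>2)) \<le> K * (\<bar>s\<bar> * inverse (1 + s\<^sup>2))"
      using mult_left_mono[OF K(2)[of s], of "\<bar>s\<bar>"] by (simp add: norm_divide mult_ac)
  qed
  from tendsto_divide[OF tendsto_diff[OF sq_plus_sq_primitive_at_bot[OF A] this], of "\<lambda>_. 2" 2]
  have lim: "(F \<longlongrightarrow> - (pi / (4 * A))) at_bot" by (simp add: F_def[abs_def])
  have "has_bochner_integral neg_lborel f (- (- (pi / (4 * A))))"
  proof (rule has_bochner_integral_neg_FTC[OF _ _ _ lim])
    show "(F has_vector_derivative f s) (at s)" for s
    proof -
      have "((\<lambda>z. z / (z\<^sup>2 + A\<^sup>2)) has_field_derivative (A\<^sup>2 - (of_real s)\<^sup>2) / ((of_real s)\<^sup>2 + A\<^sup>2)\<^sup>2) (at (of_real s))"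
        using nz[of s] by (auto intro!: derivative_eq_intros simp: power2_eq_square algebra_simps)
      from has_vector_derivative_real_field[OF this]
      have "((\<lambda>s. of_real s / ((of_real s)\<^sup>2 + A\<^sup>2)) has_vector_derivative (A\<^sup>2 - (of_real s)\<^sup>2) / ((of_real s)\<^sup>2 + A\<^sup>2)\<^sup>2) (at s)" .
      from has_vector_derivative_divide[OF has_vector_derivative_diff[OF has_vector_derivative_sq_plus_sq_primitive[OF A] this], of 2]
      have "(F has_vector_derivative (1 / ((of_real s)\<^sup>2 + A\<^sup>2) - (A\<^sup>2 - (of_real s)\<^sup>2) / ((of_real s)\<^sup>2 + A\<^sup>2)\<^sup>2) / 2) (at s)"
        unfolding F_def[abs_def] .
      also have "(1 / ((of_real s)\<^sup>2 + A\<^sup>2) - (A\<^sup>2 - (of_real s)\<^sup>2) / ((of_real s)\<^sup>2 + A\<^sup>2)\<^sup>2) / 2 = f s"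
        unfolding f_def using nz[of s] by (simp add: divide_simps power2_eq_square)
      finally show ?thesis .
    qed
    show "isCont f s" for s unfolding f_def using nz by (auto intro!: continuous_intros)
    show "F 0 = 0" by (simp add: F_def sq_plus_sq_primitive_def)
    show "integrable neg_lborel f"
    proof (rule Bochner_Integration.integrable_bound[OF
          integrable_mult_right[OF integrable_neg_inverse_1_plus_square, of "K * K"]])
      show "f \<in> borel_measurable neg_lborel" unfolding f_def by (auto intro!: measurable_restrict_space1)
      show "AE s in neg_lborel. norm (f s) \<le> norm (K * K * inverse (1 + s\<^sup>2))"
      proof (rule AE_I2)
        fix s :: real
        have p: "1 + s\<^sup>2 > 0" by (simp add: add_pos_nonneg)
        have "norm (f s) = s\<^sup>2 * (cmod (1 / ((of_real s)\<^sup>2 + A\<^sup>2)) * cmod (1 / ((of_real s)\<^sup>2 + A\<^sup>2)))"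
          by (simp add: f_def norm_divide norm_mult norm_power)
        also have "\<dots> \<le> s\<^sup>2 * ((K * inverse (1 + s\<^sup>2)) * (K * inverse (1 + s\<^sup>2)))"
          using K by (intro mult_left_mono mult_mono) auto
        also have "\<dots> = (K * K * inverse (1 + s\<^sup>2)) * (s\<^sup>2 * inverse (1 + s\<^sup>2))" by simp
        also have "\<dots> \<le> (K * K * inverse (1 + s\<^sup>2)) * 1"
          using K p by (intro mult_left_mono) (auto simp: field_simps)
        finally show "norm (f s) \<le> norm (K * K * inverse (1 + s\<^sup>2))" using K p by simp
      qed
    qed
  qed
  then show ?thesis by (simp add: f_def[abs_def])
qed

section \<open>Partial fractions with two and three poles\<close>

lemma has_bochner_integral_two_poles:
  fixes A B :: complex
  assumes A: "Re A > 0" and B: "Re B > 0 \<or> B = 0"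
  shows "has_bochner_integral neg_lborel
    (\<lambda>s. (of_real s)\<^sup>2 / (((of_real s)\<^sup>2 + A\<^sup>2) * ((of_real s)\<^sup>2 + B\<^sup>2))) (pi / (2 * (A + B)))"
proof (cases "A = B")
  case True
  then show ?thesis using has_bochner_integral_double_pole[OF A] by simp
next
  case False
  have s: "A + B \<noteq> 0" using A B by (auto simp: complex_eq_iff)
  have d: "A\<^sup>2 - B\<^sup>2 = (A - B) * (A + B)" by (simp add: algebra_simps power2_eq_square)
  have "has_bochner_integral neg_lborel (\<lambda>s. B\<^sup>2 * (1 / ((of_real s)\<^sup>2 + B\<^sup>2))) (B * (pi / 2))"
  proof (cases "B = 0")
    case False
    with B has_bochner_integral_mult_right[OF has_bochner_integral_inverse_sq_plus_sq[of B], of "B\<^sup>2"]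
    show ?thesis by (simp add: power2_eq_square)
  qed (simp add: has_bochner_integral_zero)
  moreover have "has_bochner_integral neg_lborel (\<lambda>s. A\<^sup>2 * (1 / ((of_real s)\<^sup>2 + A\<^sup>2))) (A * (pi / 2))"
  proof -
    have "A \<noteq> 0" using A by auto
    with has_bochner_integral_mult_right[OF has_bochner_integral_inverse_sq_plus_sq[OF A], of "A\<^sup>2"]
    show ?thesis by (simp add: power2_eq_square)
  qed
  ultimately have "has_bochner_integral neg_lborel
      (\<lambda>s. (A\<^sup>2 * (1 / ((of_real s)\<^sup>2 + A\<^sup>2)) - B\<^sup>2 * (1 / ((of_real s)\<^sup>2 + B\<^sup>2))) / (A\<^sup>2 - B\<^sup>2))
      ((A * (pi / 2) - B * (pi / 2)) / (A\<^sup>2 - B\<^sup>2))"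
    by (intro has_bochner_integral_divide has_bochner_integral_diff)
  also have "(A * (pi / 2) - B * (pi / 2)) / (A\<^sup>2 - B\<^sup>2) = pi / (2 * (A + B))"
  proof -
    have "(A * (pi / 2) - B * (pi / 2)) = (A - B) * (pi / 2)" by (simp add: algebra_simps)
    then show ?thesis unfolding d using False s by (simp only:) simp
  qed
  finally show ?thesis
  proof (rule has_bochner_integral_cong[THEN iffD1, rotated -1], goal_cases)
    case (2 s)
    then have s: "s < 0" by (simp add: space_restrict_space)
    have 1: "(of_real s)\<^sup>2 + A\<^sup>2 \<noteq> 0" by (rule sq_plus_sq_nonzero[OF A])
    have 2: "(of_real s)\<^sup>2 + B\<^sup>2 \<noteq> 0" using B sq_plus_sq_nonzero[of B s] s by auto
    have 3: "A\<^sup>2 - B\<^sup>2 \<noteq> 0" unfolding d using False \<open>A + B \<noteq> 0\<close> by simp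
    have "A\<^sup>2 * (1 / ((of_real s)\<^sup>2 + A\<^sup>2)) - B\<^sup>2 * (1 / ((of_real s)\<^sup>2 + B\<^sup>2))
      = (A\<^sup>2 - B\<^sup>2) * ((of_real s)\<^sup>2 / (((of_real s)\<^sup>2 + A\<^sup>2) * ((of_real s)\<^sup>2 + B\<^sup>2)))"
      using 1 2 by (simp add: divide_simps) (simp add: algebra_simps)
    then show ?case using 3 by simp
  qed auto
qed

text \<open>A divided difference in the squares of w and B reduces this to two two-pole integrals.
  Only w = B has to be excluded; w = A is covered by the double pole.\<close>

lemma has_bochner_integral_three_poles:
  fixes A B w :: complex
  assumes A: "Re A > 0" and B: "Re B > 0 \<or> B = 0" and w: "Re w > 0" "w \<noteq> B"
  shows "has_bochner_integral neg_lborel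
    (\<lambda>s. (of_real s)\<^sup>2 / (((of_real s)\<^sup>2 + A\<^sup>2) * ((of_real s)\<^sup>2 + B\<^sup>2)) / ((of_real s)\<^sup>2 + w\<^sup>2))
    (pi / (2 * (A + B) * (A + w) * (B + w)))"
proof -
  have nz: "A + B \<noteq> 0" "A + w \<noteq> 0" "B + w \<noteq> 0" "w - B \<noteq> 0" using A B w by (auto simp: complex_eq_iff)
  have d: "w\<^sup>2 - B\<^sup>2 = (w - B) * (B + w)" by (simp add: algebra_simps power2_eq_square)
  have "has_bochner_integral neg_lborel
      (\<lambda>s. ((of_real s)\<^sup>2 / (((of_real s)\<^sup>2 + A\<^sup>2) * ((of_real s)\<^sup>2 + B\<^sup>2))
          - (of_real s)\<^sup>2 / (((of_real s)\<^sup>2 + A\<^sup>2) * ((of_real s)\<^sup>2 + w\<^sup>2))) / (w\<^sup>2 - B\<^sup>2))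
      ((pi / (2 * (A + B)) - pi / (2 * (A + w))) / (w\<^sup>2 - B\<^sup>2))"
    using A B w by (intro has_bochner_integral_divide has_bochner_integral_diff has_bochner_integral_two_poles) auto
  also have "(pi / (2 * (A + B)) - pi / (2 * (A + w))) / (w\<^sup>2 - B\<^sup>2) = pi / (2 * (A + B) * (A + w) * (B + w))"
  proof -
    have "(c / (2 * p) - c / (2 * q)) / ((q - p) * r) = c / (2 * p * q * r)"
      if "p \<noteq> 0" "q \<noteq> 0" "r \<noteq> 0" "q - p \<noteq> 0" for c p q r :: complex
    proof -
      have "c / (2 * p) - c / (2 * q) = (q - p) * (c / (2 * p * q))"
        using that by (simp add: field_simps)
      then show ?thesis using that by simp
    qed
    from this[of "A + B" "A + w" "B + w" pi] show ?thesis
      unfolding d using nz by simp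
  qed
  finally show ?thesis
  proof (rule has_bochner_integral_cong[THEN iffD1, rotated -1], goal_cases)
    case (2 s)
    then have s: "s < 0" by (simp add: space_restrict_space)
    have 1: "(of_real s)\<^sup>2 + A\<^sup>2 \<noteq> 0" by (rule sq_plus_sq_nonzero[OF A])
    have 2: "(of_real s)\<^sup>2 + B\<^sup>2 \<noteq> 0" using B sq_plus_sq_nonzero[of B s] s by auto
    have 4: "(of_real s)\<^sup>2 + w\<^sup>2 \<noteq> 0" by (rule sq_plus_sq_nonzero[OF w(1)])
    have 3: "w\<^sup>2 - B\<^sup>2 \<noteq> 0" unfolding d using nz by simp
    have "(of_real s)\<^sup>2 / (((of_real s)\<^sup>2 + A\<^sup>2) * ((of_real s)\<^sup>2 + B\<^sup>2))
          - (of_real s)\<^sup>2 / (((of_real s)\<^sup>2 + A\<^sup>2) * ((of_real s)\<^sup>2 + w\<^sup>2))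
      = (w\<^sup>2 - B\<^sup>2) * ((of_real s)\<^sup>2 / (((of_real s)\<^sup>2 + A\<^sup>2) * ((of_real s)\<^sup>2 + B\<^sup>2)) / ((of_real s)\<^sup>2 + w\<^sup>2))"
      using 1 2 4 by (simp add: divide_simps) (simp add: algebra_simps)
    then show ?case using 3 by simp
  qed auto
qed

subsection \<open>The explicit law\<close>

definition cubic_disc :: "real \<Rightarrow> real \<Rightarrow> real \<Rightarrow> real" where
  "cubic_disc a b c = b\<^sup>2 - 4 * a * c"

definition cubic_edge :: "real \<Rightarrow> real \<Rightarrow> real \<Rightarrow> real" where
  "cubic_edge a b c = c - (b + 1)\<^sup>2 / (4 * a)"

definition cubic_atom :: "real \<Rightarrow> real \<Rightarrow> real \<Rightarrow> real" where
  "cubic_atom a b c = - (b + sqrt (cubic_disc a b c)) / (2 * a)"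

text \<open>In the variable s the problem depends on a, b, c only through \<Delta>, so the atom mass
  is restated as a function of \<Delta>.\<close>

definition disc_mass :: "real \<Rightarrow> real" where
  "disc_mass \<Delta> = (if \<Delta> > 1 then 1 - 1 / sqrt \<Delta> else 0)"

lemma cubic_atom_mass_eq: "cubic_atom_mass a b c = disc_mass (cubic_disc a b c)"
  by (simp add: cubic_atom_mass_def disc_mass_def cubic_disc_def)

lemma disc_mass_bounds: "0 \<le> disc_mass \<Delta>" "disc_mass \<Delta> < 1"
  by (auto simp: disc_mass_def)

section \<open>The rational kernel and its poles\<close>

text \<open>This is 16 a times the quadratic a x^2 + b x + c at x = e - s^2/(4a), with e the
  edge.\<close>

definition kernel_denom :: "real \<Rightarrow> real \<Rightarrow> real" where
  "kernel_denom \<Delta> s = (1 - \<Delta> - s\<^sup>2)\<^sup>2 + 4 * s\<^sup>2"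

lemma kernel_denom_pos: "s \<noteq> 0 \<Longrightarrow> kernel_denom \<Delta> s > 0"
  unfolding kernel_denom_def by (simp add: add_nonneg_pos)

text \<open>With r a square root of \<Delta>, A is 1 + r and B is 1 - r for \<Delta> \<le> 1 but r -
  1 for \<Delta> > 1, so that Re B is never negative. This change of sign creates the atom: A + B is
  2 in the first case and 2 r in the second. The condition Im B \<le> 0 keeps B apart from every w
  with Im w > 0.\<close>

lemma kernel_denom_factor:
  obtains A B :: complex where "Re A > 0" "Re B > 0 \<or> B = 0" "Im B \<le> 0"
    "\<And>s. of_real (kernel_denom \<Delta> s) = ((of_real s)\<^sup>2 + A\<^sup>2) * ((of_real s)\<^sup>2 + B\<^sup>2)"
    "2 / (A + B) = complex_of_real (1 - disc_mass \<Delta>)"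
    "\<And>w :: complex. Re w > 0 \<Longrightarrow> Im w > 0 \<Longrightarrow>
       2 / ((A + B) * (A + w) * (B + w)) = 1 / ((w + 1)\<^sup>2 - of_real \<Delta>) - disc_mass \<Delta> / (w\<^sup>2 - (of_real (sqrt \<Delta> - 1))\<^sup>2)"
proof -
  define r where "r = csqrt (of_real \<Delta>)"
  have r2: "r\<^sup>2 = of_real \<Delta>" by (simp add: r_def)
  have Re_r: "Re r \<ge> 0" by (simp add: r_def Re_csqrt)
  have factor: "of_real (kernel_denom \<Delta> s) = ((of_real s)\<^sup>2 + (1 + r)\<^sup>2) * ((of_real s)\<^sup>2 + (1 - r)\<^sup>2)" for s
    unfolding kernel_denom_def of_real_add of_real_mult of_real_power of_real_diff r2[symmetric] of_real_1 of_real_numeral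
    by algebra
  show ?thesis
  proof (cases "\<Delta> \<le> 1")
    case True
    have p: "disc_mass \<Delta> = 0" using True by (simp add: disc_mass_def)
    have B: "Re (1 - r) > 0 \<or> 1 - r = 0" "Im (1 - r) \<le> 0"
    proof -
      consider "\<Delta> < 0" | "0 \<le> \<Delta>" "\<Delta> < 1" | "\<Delta> = 1" using True by linarith
      then have "(Re (1 - r) > 0 \<or> 1 - r = 0) \<and> Im (1 - r) \<le> 0"
        by cases (auto simp: r_def csqrt_of_real_nonneg csqrt_of_real_nonpos)
      then show "Re (1 - r) > 0 \<or> 1 - r = 0" "Im (1 - r) \<le> 0" by auto
    qed
    show ?thesis
    proof (rule that[of "1 + r" "1 - r"])
      fix w :: complex
      have "(1 + r + (1 - r)) * (1 + r + w) * (1 - r + w) = 2 * ((w + 1)\<^sup>2 - of_real \<Delta>)"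
        unfolding r2[symmetric] by algebra
      then have "2 / ((1 + r + (1 - r)) * (1 + r + w) * (1 - r + w)) = 1 / ((w + 1)\<^sup>2 - of_real \<Delta>)"
        by (metis mult_divide_mult_cancel_left mult.right_neutral zero_neq_numeral)
      then show "2 / ((1 + r + (1 - r)) * (1 + r + w) * (1 - r + w))
        = 1 / ((w + 1)\<^sup>2 - of_real \<Delta>) - disc_mass \<Delta> / (w\<^sup>2 - (of_real (sqrt \<Delta> - 1))\<^sup>2)"
        by (simp only: p) simp
    qed (use B Re_r p factor in auto)
  next
    case False
    define q where "q = sqrt \<Delta>"
    have rq: "r = of_real q" using False by (simp add: r_def q_def csqrt_of_real_nonneg)
    have q: "q > 1" using False by (simp add: q_def)
    have p: "disc_mass \<Delta> = 1 - 1 / q" using False by (simp add: disc_mass_def q_def)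
    have D: "of_real \<Delta> = (of_real q :: complex)\<^sup>2" using r2 rq by simp
    show ?thesis
    proof (rule that[of "1 + r" "r - 1"])
      show "of_real (kernel_denom \<Delta> s) = ((of_real s)\<^sup>2 + (1 + r)\<^sup>2) * ((of_real s)\<^sup>2 + (r - 1)\<^sup>2)" for s
        unfolding factor by (simp add: power2_commute)
      show "2 / (1 + r + (r - 1)) = complex_of_real (1 - disc_mass \<Delta>)"
        using q by (simp add: p rq)
      fix w :: complex assume w: "Re w > 0" "Im w > 0"
      define Q where "Q = complex_of_real q"
      have nz: "Q \<noteq> 0" "w + 1 + Q \<noteq> 0" "w + Q - 1 \<noteq> 0" "w + 1 - Q \<noteq> 0"
        using w q by (auto simp: Q_def complex_eq_iff)
      have "1 / ((w + 1)\<^sup>2 - Q\<^sup>2) - (1 - 1 / Q) / (w\<^sup>2 - (Q - 1)\<^sup>2) = 2 / ((2 * Q) * (1 + Q + w) * (Q - 1 + w))"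
      proof -
        have 1: "(w + 1)\<^sup>2 - Q\<^sup>2 = (w + 1 + Q) * (w + 1 - Q)" by algebra
        have 2: "w\<^sup>2 - (Q - 1)\<^sup>2 = (w + Q - 1) * (w + 1 - Q)" by algebra
        have 3: "1 + Q + w = w + 1 + Q" "Q - 1 + w = w + Q - 1" by simp_all
        have 4: "1 - 1 / Q = (Q - 1) / Q" using nz by (simp add: field_simps)
        \<comment> \<open>S is the factor that vanishes at the pole w = Q - 1 of the atom. The
          numerator Q R - (Q - 1) P equals S, so this pole cancels from the difference.\<close>
        have K: "1 / (P * S) - ((Q - 1) / Q) / (R * S) = 2 / (2 * Q * P * R)"
          if "P \<noteq> 0" "R \<noteq> 0" "S \<noteq> 0" "Q * R - (Q - 1) * P = S" for P R S
        proof -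
          have "1 / (P * S) - ((Q - 1) / Q) / (R * S) = (Q * R - (Q - 1) * P) / (Q * P * R * S)"
            using that(1-3) nz by (simp add: divide_simps)
          then show ?thesis using that nz by simp
        qed
        show ?thesis unfolding 1 2 3 4 by (rule K) (use nz in \<open>auto simp: algebra_simps\<close>)
      qed
      then show "2 / ((1 + r + (r - 1)) * (1 + r + w) * (r - 1 + w))
        = 1 / ((w + 1)\<^sup>2 - of_real \<Delta>) - disc_mass \<Delta> / (w\<^sup>2 - (of_real (sqrt \<Delta> - 1))\<^sup>2)"
        unfolding D rq p q_def[symmetric] by (simp add: Q_def)
    qed (use q rq in auto)
  qed
qed

text \<open>The two-pole integral gives the total mass 2 / (A + B) of the absolutely continuous
  part; what is missing from 1 is the atom.\<close>

lemma has_bochner_integral_kernel: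
  "has_bochner_integral neg_lborel (\<lambda>s. 4 * s\<^sup>2 / (pi * kernel_denom \<Delta> s)) (1 - disc_mass \<Delta>)"
proof -
  obtain A B :: complex where AB: "Re A > 0" "Re B > 0 \<or> B = 0"
    "\<And>s. of_real (kernel_denom \<Delta> s) = ((of_real s)\<^sup>2 + A\<^sup>2) * ((of_real s)\<^sup>2 + B\<^sup>2)"
    "2 / (A + B) = complex_of_real (1 - disc_mass \<Delta>)"
    by (rule kernel_denom_factor[of \<Delta>]) blast
  have "has_bochner_integral neg_lborel
     (\<lambda>s. Re (4 / pi * ((of_real s)\<^sup>2 / (((of_real s)\<^sup>2 + A\<^sup>2) * ((of_real s)\<^sup>2 + B\<^sup>2)))))
     (Re (4 / pi * (pi / (2 * (A + B)))))"
    by (intro has_bochner_integral_bounded_linear[OF bounded_linear_Re] has_bochner_integral_mult_right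
          has_bochner_integral_two_poles AB)
  also have "4 / pi * (pi / (2 * (A + B))) = 2 / (A + B)"
  proof -
    have "4 / pi * (pi / (2 * X)) = 2 / X" for X :: complex by (cases "X = 0") (auto simp: field_simps)
    then show ?thesis .
  qed
  also have "Re \<dots> = 1 - disc_mass \<Delta>" unfolding AB(4) by simp
  also have "(\<lambda>s. Re (4 / pi * ((of_real s)\<^sup>2 / (((of_real s)\<^sup>2 + A\<^sup>2) * ((of_real s)\<^sup>2 + B\<^sup>2)))))
    = (\<lambda>s. 4 * s\<^sup>2 / (pi * kernel_denom \<Delta> s))"
  proof
    fix s
    have "4 / pi * ((of_real s)\<^sup>2 / (((of_real s)\<^sup>2 + A\<^sup>2) * ((of_real s)\<^sup>2 + B\<^sup>2))) 
      = complex_of_real (4 * s\<^sup>2 / (pi * kernel_denom \<Delta> s))"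
      unfolding AB(3)[symmetric] by simp
    then show "Re (4 / pi * ((of_real s)\<^sup>2 / (((of_real s)\<^sup>2 + A\<^sup>2) * ((of_real s)\<^sup>2 + B\<^sup>2)))) = 4 * s\<^sup>2 / (pi * kernel_denom \<Delta> s)"
      by (simp only: Re_complex_of_real)
  qed
  finally show ?thesis .
qed

text \<open>With w^2 = 4a(z - e), the factor 1/(s^2 + w^2) is the Cauchy kernel up to 4a. The
  subtracted term is the contribution of the atom, which the density does not contain.\<close>

lemma has_bochner_integral_kernel_resolvent:
  fixes w :: complex
  assumes w: "Re w > 0" "Im w > 0"
  shows "has_bochner_integral neg_lborel
    (\<lambda>s. of_real (4 * s\<^sup>2 / (pi * kernel_denom \<Delta> s)) / ((of_real s)\<^sup>2 + w\<^sup>2))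
    (1 / ((w + 1)\<^sup>2 - of_real \<Delta>) - disc_mass \<Delta> / (w\<^sup>2 - (of_real (sqrt \<Delta> - 1))\<^sup>2))"
proof -
  obtain A B :: complex where AB: "Re A > 0" "Re B > 0 \<or> B = 0" "Im B \<le> 0"
    "\<And>s. of_real (kernel_denom \<Delta> s) = ((of_real s)\<^sup>2 + A\<^sup>2) * ((of_real s)\<^sup>2 + B\<^sup>2)"
    "\<And>w :: complex. Re w > 0 \<Longrightarrow> Im w > 0 \<Longrightarrow>
       2 / ((A + B) * (A + w) * (B + w)) = 1 / ((w + 1)\<^sup>2 - of_real \<Delta>) - disc_mass \<Delta> / (w\<^sup>2 - (of_real (sqrt \<Delta> - 1))\<^sup>2)"
    by (rule kernel_denom_factor[of \<Delta>]) blast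
  have "w \<noteq> B" using AB w by auto
  then have "has_bochner_integral neg_lborel
     (\<lambda>s. 4 / pi * ((of_real s)\<^sup>2 / (((of_real s)\<^sup>2 + A\<^sup>2) * ((of_real s)\<^sup>2 + B\<^sup>2)) / ((of_real s)\<^sup>2 + w\<^sup>2)))
     (4 / pi * (pi / (2 * (A + B) * (A + w) * (B + w))))"
    using AB w by (intro has_bochner_integral_mult_right has_bochner_integral_three_poles) auto
  also have "4 / pi * (pi / (2 * (A + B) * (A + w) * (B + w))) = 2 / ((A + B) * (A + w) * (B + w))"
  proof -
    have "4 / pi * (pi / (2 * X)) = 2 / X" for X :: complex by (cases "X = 0") (auto simp: field_simps)
    from this[of "(A + B) * (A + w) * (B + w)"] show ?thesis by (simp only: mult.assoc)
  qed
  also note AB(5)[OF w]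
  also have "(\<lambda>s. 4 / pi * ((of_real s)\<^sup>2 / (((of_real s)\<^sup>2 + A\<^sup>2) * ((of_real s)\<^sup>2 + B\<^sup>2)) / ((of_real s)\<^sup>2 + w\<^sup>2)))
    = (\<lambda>s. of_real (4 * s\<^sup>2 / (pi * kernel_denom \<Delta> s)) / ((of_real s)\<^sup>2 + w\<^sup>2))"
    unfolding AB(4)[symmetric] by (simp add: mult_ac)
  finally show ?thesis .
qed

section \<open>The change of variable below the edge\<close>

text \<open>Locates the atom in the coordinate w, where w^2 = 4a(z - e): it never lies below the
  edge, and it meets the edge exactly when \<Delta> = 1.\<close>

lemma cubic_atom_conv_edge:
  assumes "a > 0" "cubic_disc a b c \<ge> 0"
  shows "4 * a * (cubic_atom a b c - cubic_edge a b c) = (sqrt (cubic_disc a b c) - 1)\<^sup>2"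
proof -
  have "(sqrt (cubic_disc a b c))\<^sup>2 = b\<^sup>2 - 4 * a * c" using assms by (simp add: cubic_disc_def)
  moreover have "4 * a * cubic_edge a b c = 4 * a * c - (b + 1)\<^sup>2"
    using assms by (simp add: cubic_edge_def right_diff_distrib)
  moreover have "4 * a * cubic_atom a b c = - 2 * (b + sqrt (cubic_disc a b c))"
    using assms by (simp add: cubic_atom_def)
  ultimately show ?thesis by algebra
qed

text \<open>With \<open>z = e + W / (4 a)\<close>, \<open>e\<close> the edge, the quadratic \<open>a z\<^sup>2 + b z + c\<close> takes this form;
  \<open>W = - s\<^sup>2\<close> parametrises the half-line below the edge.\<close>

lemma quadratic_at_edge_shift:
  fixes W :: "'a :: {real_algebra_1, field}"
  assumes "a > 0"
  shows "16 * of_real a * (of_real c + of_real b * (of_real (cubic_edge a b c) + W / (4 * of_real a))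
      + of_real a * (of_real (cubic_edge a b c) + W / (4 * of_real a))\<^sup>2)
    = (W + 1 - of_real (cubic_disc a b c))\<^sup>2 - 4 * W"
proof -
  have a: "(of_real a :: 'a) \<noteq> 0" using assms by simp
  define e :: 'a where "e = of_real (cubic_edge a b c)"
  define z where "z = e + W / (4 * of_real a)"
  have e: "4 * of_real a * e = 4 * of_real a * of_real c - (of_real b + 1)\<^sup>2"
  proof -
    have "4 * a * cubic_edge a b c = 4 * a * c - (b + 1)\<^sup>2"
      using assms by (simp add: cubic_edge_def right_diff_distrib)
    from arg_cong[OF this, of of_real] show ?thesis by (simp add: e_def)
  qed
  have "4 * of_real a * z = 4 * of_real a * e + W"
    unfolding z_def using a by (simp add: distrib_left)
  then have W: "W = 4 * of_real a * z - 4 * of_real a * of_real c + (of_real b + 1)\<^sup>2"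
    unfolding e by simp
  have D: "of_real (cubic_disc a b c) = ((of_real b)\<^sup>2 - 4 * of_real a * of_real c :: 'a)"
    by (simp add: cubic_disc_def)
  have "16 * of_real a * (of_real c + of_real b * z + of_real a * z\<^sup>2) = (W + 1 - of_real (cubic_disc a b c))\<^sup>2 - 4 * W"
    unfolding W D by algebra
  then show ?thesis by (simp add: z_def e_def)
qed

lemma quadratic_below_edge:
  assumes "a > 0"
  shows "c + b * (cubic_edge a b c - s\<^sup>2 / (4 * a)) + a * (cubic_edge a b c - s\<^sup>2 / (4 * a))\<^sup>2
    = kernel_denom (cubic_disc a b c) s / (16 * a)"
  using quadratic_at_edge_shift[OF assms, where 'a=real, of c b "- s\<^sup>2"] assms
  by (simp add: kernel_denom_def field_simps power2_commute)

lemma quadratic_pos_below_edge: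
  assumes "a > 0" "x < cubic_edge a b c"
  shows "c + b * x + a * x\<^sup>2 > 0"
proof -
  define s where "s = sqrt (4 * a * (cubic_edge a b c - x))"
  have "s > 0" using assms by (simp add: s_def)
  moreover have "x = cubic_edge a b c - s\<^sup>2 / (4 * a)" using assms by (simp add: s_def)
  ultimately show ?thesis
    using quadratic_below_edge[OF assms(1), of c b s] kernel_denom_pos[of s] assms(1) by simp
qed

lemma cubic_density_above_edge: "x \<ge> cubic_edge a b c \<Longrightarrow> cubic_density a b c x = 0"
  by (simp add: cubic_density_def cubic_edge_def)

lemma cubic_density_pos:
  assumes "a > 0" "x < cubic_edge a b c"
  shows "cubic_density a b c x > 0"
proof -
  have "4 * a * c - (b + 1)\<^sup>2 - 4 * a * x = 4 * a * (cubic_edge a b c - x)"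
    using assms by (simp add: cubic_edge_def field_simps)
  moreover have "x < c - (b + 1)\<^sup>2 / (4 * a)" using assms(2) by (simp add: cubic_edge_def)
  ultimately show ?thesis
    using quadratic_pos_below_edge[OF assms] assms unfolding cubic_density_def by simp
qed

lemma cubic_density_nonneg: "a > 0 \<Longrightarrow> cubic_density a b c x \<ge> 0"
  by (cases "x < cubic_edge a b c") (auto simp: cubic_density_above_edge intro: less_imp_le[OF cubic_density_pos])

lemma cubic_density_measurable [measurable]: "cubic_density a b c \<in> borel_measurable borel"
  unfolding cubic_density_def by measurable

text \<open>The factor -s/(2a) is the Jacobian, and the square root in the density becomes -s
  because s is negative.\<close>

lemma cubic_density_substitution:
  assumes a: "a > 0" and s: "s < 0"
  shows "cubic_density a b c (cubic_edge a b c - s\<^sup>2 / (4 * a)) * (- s / (2 * a))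
    = 4 * s\<^sup>2 / (pi * kernel_denom (cubic_disc a b c) s)"
proof -
  have "s\<^sup>2 / (4 * a) > 0" using assms by simp
  then have ind: "indicator {..<c - (b + 1)\<^sup>2 / (4 * a)} (cubic_edge a b c - s\<^sup>2 / (4 * a)) = (1::real)"
    by (simp add: cubic_edge_def)
  have "4 * a * c - (b + 1)\<^sup>2 - 4 * a * (cubic_edge a b c - s\<^sup>2 / (4 * a)) = s\<^sup>2"
    using a by (simp add: cubic_edge_def field_simps)
  then have sq: "sqrt (4 * a * c - (b + 1)\<^sup>2 - 4 * a * (cubic_edge a b c - s\<^sup>2 / (4 * a))) = - s"
    using s by simp
  show ?thesis
    unfolding cubic_density_def quadratic_below_edge[OF a] ind sq
    using a by (simp add: power2_eq_square)
qed

lemma continuous_cubic_density_below_edge: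
  assumes "a > 0" "x < cubic_edge a b c"
  shows "isCont (cubic_density a b c) x"
proof -
  let ?f = "\<lambda>x. sqrt (4 * a * c - (b + 1)\<^sup>2 - 4 * a * x) / (2 * pi * (c + b * x + a * x\<^sup>2))"
  have "isCont ?f x"
    using quadratic_pos_below_edge[OF assms] by (intro continuous_intros) auto
  moreover have "\<forall>\<^sub>F y in nhds x. ?f y = cubic_density a b c y"
    using eventually_nhds_in_open[of "{..<cubic_edge a b c}" x] assms
    by (auto simp: cubic_density_def cubic_edge_def elim!: eventually_mono)
  ultimately show ?thesis by (rule_tac isCont_cong[THEN iffD1]) 
qed

lemma edge_param_limits:
  assumes a: "a > 0"
  shows "((ereal \<circ> (\<lambda>s. e - s\<^sup>2 / (4 * a)) \<circ> real_of_ereal) \<longlongrightarrow> -\<infinity>) (at_right (-\<infinity>))"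
    and "((ereal \<circ> (\<lambda>s. e - s\<^sup>2 / (4 * a)) \<circ> real_of_ereal) \<longlongrightarrow> ereal e) (at_left (ereal 0))"
proof -
  have "filterlim (\<lambda>s. e - s\<^sup>2 / (4 * a)) at_bot at_bot" using a by real_asymp
  then show "((ereal \<circ> (\<lambda>s. e - s\<^sup>2 / (4 * a)) \<circ> real_of_ereal) \<longlongrightarrow> -\<infinity>) (at_right (-\<infinity>))"
    by (simp only: ereal_tendsto_simps comp_assoc[symmetric])
  have "((\<lambda>s. e - s\<^sup>2 / (4 * a)) \<longlongrightarrow> e) (at_left 0)" using a by real_asymp
  then show "((ereal \<circ> (\<lambda>s. e - s\<^sup>2 / (4 * a)) \<circ> real_of_ereal) \<longlongrightarrow> ereal e) (at_left (ereal 0))"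
    by (simp only: ereal_tendsto_simps)
qed

lemma restrict_cubic_density:
  fixes f :: "real \<Rightarrow> 'a :: {banach, second_countable_topology}"
  shows "integrable (restrict_space lborel {..<cubic_edge a b c}) (\<lambda>x. cubic_density a b c x *\<^sub>R f x)
       \<longleftrightarrow> integrable lborel (\<lambda>x. cubic_density a b c x *\<^sub>R f x)"
    and "integral\<^sup>L (restrict_space lborel {..<cubic_edge a b c}) (\<lambda>x. cubic_density a b c x *\<^sub>R f x)
       = (LBINT x. cubic_density a b c x *\<^sub>R f x)"
proof -
  have eq: "(\<lambda>x. indicator {..<cubic_edge a b c} x *\<^sub>R cubic_density a b c x *\<^sub>R f x) = (\<lambda>x. cubic_density a b c x *\<^sub>R f x)"
    by (rule ext, rename_tac x, case_tac "x < cubic_edge a b c") (simp_all add: cubic_density_above_edge)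
  show "integrable (restrict_space lborel {..<cubic_edge a b c}) (\<lambda>x. cubic_density a b c x *\<^sub>R f x)
       \<longleftrightarrow> integrable lborel (\<lambda>x. cubic_density a b c x *\<^sub>R f x)"
    using integrable_restrict_space[of "{..<cubic_edge a b c}" lborel "\<lambda>x. cubic_density a b c x *\<^sub>R f x"]
    by (simp add: eq del: scaleR_scaleR)
  show "integral\<^sup>L (restrict_space lborel {..<cubic_edge a b c}) (\<lambda>x. cubic_density a b c x *\<^sub>R f x)
       = (LBINT x. cubic_density a b c x *\<^sub>R f x)"
    using integral_restrict_space[of "{..<cubic_edge a b c}" lborel "\<lambda>x. cubic_density a b c x *\<^sub>R f x"]
    by (simp add: eq del: scaleR_scaleR)
qed

lemma has_bochner_integral_cubic_density:
  assumes a: "a > 0"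
  shows "has_bochner_integral lborel (cubic_density a b c) (1 - cubic_atom_mass a b c)"
proof -
  let ?e = "cubic_edge a b c"
  let ?g = "\<lambda>s. ?e - s\<^sup>2 / (4 * a)"
  let ?k = "\<lambda>s. 4 * s\<^sup>2 / (pi * kernel_denom (cubic_disc a b c) s)"
  have g_less: "?g s < ?e" if "s < 0" for s using that a by simp
  have eq: "integrable neg_lborel (\<lambda>s. cubic_density a b c (?g s) * (- s / (2 * a))) \<longleftrightarrow> integrable neg_lborel ?k"
    "(\<integral>s. cubic_density a b c (?g s) * (- s / (2 * a)) \<partial>neg_lborel) = integral\<^sup>L neg_lborel ?k"
    using cubic_density_substitution[OF a]
    by (intro Bochner_Integration.integrable_cong Bochner_Integration.integral_cong; simp add: space_restrict_space)+
  have int: "set_integrable lborel (einterval (-\<infinity>) (ereal 0)) (\<lambda>s. cubic_density a b c (?g s) * (- s / (2 * a)))"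
    using has_bochner_integral_kernel[of "cubic_disc a b c"]
    by (simp only: set_integrable_minf eq has_bochner_integral_iff)
  have "((\<lambda>s. ?g s) has_real_derivative (- s / (2 * a))) (at s)" for s
    using a by (auto intro!: derivative_eq_intros simp: field_simps)
  \<comment> \<open>For nonnegative integrands the substitution theorem also yields integrability of
    the original function; both conclusions share these premises.\<close>
  note subst = interval_integral_substitution_nonneg[of "-\<infinity>" "ereal 0" ?g "\<lambda>s. - s / (2 * a)" "cubic_density a b c",
    OF _ this _ _ _ _ edge_param_limits[OF a, of ?e] int]
  have "set_integrable lborel (einterval (-\<infinity>) (ereal ?e)) (cubic_density a b c)"
    using a g_less by (intro subst) (auto intro!: continuous_cubic_density_below_edge cubic_density_nonneg simp: divide_le_0_iff)
  then have 1: "integrable lborel (cubic_density a b c)"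
    unfolding set_integrable_minf using restrict_cubic_density(1)[where f="\<lambda>_. 1::real"] by simp
  have "(LBINT x=-\<infinity>..ereal ?e. cubic_density a b c x) = (LBINT s=-\<infinity>..ereal 0. cubic_density a b c (?g s) * (- s / (2 * a)))"
    using a g_less by (intro subst) (auto intro!: continuous_cubic_density_below_edge cubic_density_nonneg simp: divide_le_0_iff)
  then have "integral\<^sup>L lborel (cubic_density a b c) = integral\<^sup>L neg_lborel ?k"
    unfolding interval_integral_minf eq using restrict_cubic_density(2)[where f="\<lambda>_. 1::real"] by simp
  with 1 show ?thesis
    using has_bochner_integral_kernel[of "cubic_disc a b c"]
    by (simp add: has_bochner_integral_iff cubic_atom_mass_eq)
qed

section \<open>Closed form of the Cauchy transform\<close>

definition cubic_sqrt :: "real \<Rightarrow> real \<Rightarrow> real \<Rightarrow> complex \<Rightarrow> complex" where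
  "cubic_sqrt a b c z = csqrt ((of_real b + 1)\<^sup>2 + 4 * of_real a * (z - of_real c))"

text \<open>This is \<open>cubic_cauchy\<close> with rationalised numerator. For a > 0 and Im z > 0
  its denominator has no zero, since w lies in the open first quadrant, so it is also correct at the
  removable singularity.\<close>

definition cubic_G :: "real \<Rightarrow> real \<Rightarrow> real \<Rightarrow> complex \<Rightarrow> complex" where
  "cubic_G a b c z = 4 * of_real a / ((cubic_sqrt a b c z + 1)\<^sup>2 - of_real (cubic_disc a b c))"

lemma cubic_sqrt_arg:
  fixes z :: complex
  assumes "a > 0"
  shows "(of_real b + 1)\<^sup>2 + 4 * of_real a * (z - of_real c) = 4 * of_real a * (z - of_real (cubic_edge a b c))"
proof -
  have "4 * a * cubic_edge a b c = 4 * a * c - (b + 1)\<^sup>2"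
    using assms by (simp add: cubic_edge_def right_diff_distrib)
  from arg_cong[OF this, of complex_of_real] show ?thesis by (simp add: algebra_simps)
qed

lemma cubic_sqrt_sq:
  fixes z :: complex
  shows "a > 0 \<Longrightarrow> (cubic_sqrt a b c z)\<^sup>2 = 4 * of_real a * (z - of_real (cubic_edge a b c))"
  by (simp add: cubic_sqrt_def cubic_sqrt_arg)

text \<open>The product 2 Re w Im w = Im (w^2) is positive, and the principal root has nonnegative
  real part, which fixes both signs.\<close>

lemma cubic_sqrt_quadrant:
  fixes z :: complex
  assumes "a > 0" "Im z > 0"
  shows "Re (cubic_sqrt a b c z) > 0" "Im (cubic_sqrt a b c z) > 0"
proof -
  have "2 * Re (cubic_sqrt a b c z) * Im (cubic_sqrt a b c z) = Im ((cubic_sqrt a b c z)\<^sup>2)"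
    by (simp add: power2_eq_square)
  also have "\<dots> > 0" unfolding cubic_sqrt_sq[OF assms(1)] using assms by simp
  finally have "Re (cubic_sqrt a b c z) * Im (cubic_sqrt a b c z) > 0" by (simp add: mult.commute)
  moreover have "Re (cubic_sqrt a b c z) \<ge> 0"
    by (use csqrt_principal[of "(of_real b + 1)\<^sup>2 + 4 * of_real a * (z - of_real c)"] in \<open>auto simp: cubic_sqrt_def\<close>)
  ultimately show "Re (cubic_sqrt a b c z) > 0" "Im (cubic_sqrt a b c z) > 0"
    by (auto simp: zero_less_mult_iff)
qed

lemma cubic_G_denom:
  fixes z :: complex
  assumes "a > 0"
  shows "(cubic_sqrt a b c z + 1)\<^sup>2 - of_real (cubic_disc a b c)
    = 2 * (2 * of_real a * z + of_real b + 1 + cubic_sqrt a b c z)"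
proof -
  have "(cubic_sqrt a b c z)\<^sup>2 = (of_real b + 1)\<^sup>2 + 4 * of_real a * (z - of_real c)"
    by (simp add: cubic_sqrt_def)
  moreover have "of_real (cubic_disc a b c) = (of_real b)\<^sup>2 - 4 * of_real a * complex_of_real c"
    by (simp add: cubic_disc_def)
  ultimately show ?thesis by algebra
qed

lemma quadratic_conv_cubic_sqrt:
  fixes z :: complex
  shows
  "4 * of_real a * (of_real c + of_real b * z + of_real a * z\<^sup>2)
    = (of_real b + 1 + 2 * of_real a * z - cubic_sqrt a b c z) * (2 * of_real a * z + of_real b + 1 + cubic_sqrt a b c z)"
proof -
  have "(cubic_sqrt a b c z)\<^sup>2 = (of_real b + 1)\<^sup>2 + 4 * of_real a * (z - of_real c)"
    by (simp add: cubic_sqrt_def)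
  then show ?thesis by algebra
qed

text \<open>Multiplying the numerator by its conjugate with the opposite sign of the root gives 4a
  times the quadratic.\<close>

lemma cubic_cauchy_eq_cubic_G:
  fixes z :: complex
  assumes a: "a > 0" and q: "of_real c + of_real b * z + of_real a * z\<^sup>2 \<noteq> 0"
  shows "cubic_cauchy a b c z = cubic_G a b c z"
proof -
  define Q where "Q = of_real c + of_real b * z + of_real a * z\<^sup>2"
  define N where "N = of_real b + 1 + 2 * of_real a * z - cubic_sqrt a b c z"
  define P where "P = 2 * of_real a * z + of_real b + 1 + cubic_sqrt a b c z"
  have e: "4 * of_real a * Q = N * P"
    unfolding N_def P_def Q_def by (rule quadratic_conv_cubic_sqrt)
  have "N * P \<noteq> 0" using q a unfolding e[symmetric] Q_def by simp
  then have "P \<noteq> 0" "Q \<noteq> 0" using e by auto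
  then have "N / (2 * Q) = 4 * of_real a / (2 * P)"
    using e by (simp add: divide_simps) (simp add: algebra_simps)
  then show ?thesis
    unfolding cubic_G_def cubic_G_denom[OF a] by (simp add: cubic_cauchy_def N_def P_def Q_def cubic_sqrt_def)
qed

text \<open>Under the substitution z - x becomes (s^2 + w^2)/(4a), which leads to the three-pole
  integral. For \<Delta> > 1 the location of the atom turns w^2 - (sqrt \<Delta> - 1)^2 into 4a(z -
  atom).\<close>

lemma has_bochner_integral_cubic_density_resolvent:
  fixes z :: complex
  assumes a: "a > 0" and z: "Im z > 0"
  shows "has_bochner_integral lborel (\<lambda>x. cubic_density a b c x *\<^sub>R (1 / (z - of_real x)))
    (cubic_G a b c z - cubic_atom_mass a b c / (z - of_real (cubic_atom a b c)))"
proof -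
  let ?e = "cubic_edge a b c"
  let ?g = "\<lambda>s. ?e - s\<^sup>2 / (4 * a)"
  let ?k = "\<lambda>s. 4 * s\<^sup>2 / (pi * kernel_denom (cubic_disc a b c) s)"
  define w where "w = cubic_sqrt a b c z"
  have w: "Re w > 0" "Im w > 0" using cubic_sqrt_quadrant[OF a z] by (auto simp: w_def)
  have w2: "w\<^sup>2 = 4 * of_real a * (z - of_real ?e)" unfolding w_def by (rule cubic_sqrt_sq[OF a])
  have g_less: "?g s < ?e" if "s < 0" for s using that a by simp
  have zg: "z - of_real (?g s) = ((of_real s)\<^sup>2 + w\<^sup>2) / (4 * of_real a)" for s
    unfolding w2 using a by (simp add: field_simps)
  have nz: "z - of_real x \<noteq> 0" for x using z by (auto simp: complex_eq_iff)
  let ?h = "\<lambda>s. (- s / (2 * a)) *\<^sub>R (cubic_density a b c (?g s) *\<^sub>R (1 / (z - of_real (?g s))))"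
  have eq: "?h s = 4 * of_real a * (of_real (?k s) / ((of_real s)\<^sup>2 + w\<^sup>2))" if "s < 0" for s
  proof -
    have "?h s = (cubic_density a b c (?g s) * (- s / (2 * a))) *\<^sub>R (1 / (z - of_real (?g s)))" by simp
    also have "\<dots> = 4 * of_real a * (of_real (?k s) / ((of_real s)\<^sup>2 + w\<^sup>2))"
      unfolding cubic_density_substitution[OF a that] zg by (simp add: scaleR_conv_of_real)
    finally show ?thesis .
  qed
  have "has_bochner_integral neg_lborel (\<lambda>s. 4 * of_real a * (of_real (?k s) / ((of_real s)\<^sup>2 + w\<^sup>2)))
     (4 * of_real a * (1 / ((w + 1)\<^sup>2 - of_real (cubic_disc a b c)) -
        disc_mass (cubic_disc a b c) / (w\<^sup>2 - (of_real (sqrt (cubic_disc a b c) - 1))\<^sup>2)))"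
    by (intro has_bochner_integral_mult_right has_bochner_integral_kernel_resolvent w)
  also have "4 * of_real a * (1 / ((w + 1)\<^sup>2 - of_real (cubic_disc a b c)) -
        disc_mass (cubic_disc a b c) / (w\<^sup>2 - (of_real (sqrt (cubic_disc a b c) - 1))\<^sup>2))
     = cubic_G a b c z - cubic_atom_mass a b c / (z - of_real (cubic_atom a b c))"
  proof (cases "cubic_disc a b c > 1")
    case True
    have "4 * a * cubic_atom a b c = 4 * a * ?e + (sqrt (cubic_disc a b c) - 1)\<^sup>2"
      using cubic_atom_conv_edge[OF a, of b c] True by (simp add: algebra_simps)
    from arg_cong[OF this, of complex_of_real]
    have "4 * complex_of_real a * of_real (cubic_atom a b c) = 4 * of_real a * of_real ?e + (of_real (sqrt (cubic_disc a b c) - 1))\<^sup>2"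
      by simp
    then have "w\<^sup>2 - (of_real (sqrt (cubic_disc a b c) - 1))\<^sup>2 = 4 * of_real a * (z - of_real (cubic_atom a b c))"
      unfolding w2 by (simp add: algebra_simps)
    then have "4 * of_real a * (disc_mass (cubic_disc a b c) / (w\<^sup>2 - (of_real (sqrt (cubic_disc a b c) - 1))\<^sup>2))
       = cubic_atom_mass a b c / (z - of_real (cubic_atom a b c))"
      using a nz by (simp add: cubic_atom_mass_eq)
    then show ?thesis by (simp add: right_diff_distrib cubic_G_def w_def)
  next
    case False
    then show ?thesis by (simp add: cubic_atom_mass_eq disc_mass_def cubic_G_def w_def)
  qed
  finally have H: "has_bochner_integral neg_lborel ?h
      (cubic_G a b c z - cubic_atom_mass a b c / (z - of_real (cubic_atom a b c)))"
  proof (rule has_bochner_integral_cong[THEN iffD2, rotated -1], goal_cases)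
    case (2 s)
    then have "s < 0" by (simp add: space_restrict_space)
    then show ?case by (rule eq)
  qed auto
  \<comment> \<open>For a complex integrand the substitution theorem requires integrability on both
    sides in advance; here the Cauchy kernel is bounded by 1 / Im z.\<close>
  have int: "integrable lborel (\<lambda>x. cubic_density a b c x *\<^sub>R (1 / (z - of_real x)))"
  proof (rule Bochner_Integration.integrable_bound)
    show "integrable lborel (\<lambda>x. cubic_density a b c x * (1 / Im z))"
      using has_bochner_integral_cubic_density[OF a] by (simp add: has_bochner_integral_iff)
    show "AE x in lborel. norm (cubic_density a b c x *\<^sub>R (1 / (z - of_real x))) \<le> norm (cubic_density a b c x * (1 / Im z))"
    proof (rule AE_I2)
      fix x
      have "cmod (1 / (z - of_real x)) \<le> 1 / Im z"
        using cmod_diff_of_real_ge_Im[of z x] z by (auto simp: norm_divide intro!: frac_le)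
      then show "norm (cubic_density a b c x *\<^sub>R (1 / (z - of_real x))) \<le> norm (cubic_density a b c x * (1 / Im z))"
        unfolding norm_scaleR norm_mult using z by (intro mult_mono) auto
    qed
  qed measurable
  have deriv: "((\<lambda>s. ?g s) has_real_derivative (- s / (2 * a))) (at s)" for s
    using a by (auto intro!: derivative_eq_intros simp: field_simps)
  have "(LBINT x=-\<infinity>..ereal ?e. cubic_density a b c x *\<^sub>R (1 / (z - of_real x))) = (LBINT s=-\<infinity>..ereal 0. ?h s)"
  proof (rule interval_integral_substitution_integrable[of "-\<infinity>" "ereal 0" ?g "\<lambda>s. - s / (2 * a)"
        "\<lambda>x. cubic_density a b c x *\<^sub>R (1 / (z - of_real x))", OF _ deriv _ _ _ edge_param_limits[OF a, of ?e]])
    show "set_integrable lborel (einterval (-\<infinity>) (ereal 0)) ?h"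
      using H unfolding set_integrable_minf by (simp only: has_bochner_integral_iff)
    show "set_integrable lborel (einterval (-\<infinity>) (ereal ?e)) (\<lambda>x. cubic_density a b c x *\<^sub>R (1 / (z - of_real x)))"
      unfolding set_integrable_minf restrict_cubic_density using int .
    show "isCont (\<lambda>x. cubic_density a b c x *\<^sub>R (1 / (z - of_real x))) (?g s)" if "ereal s < ereal 0" for s
      using nz[of "?g s"] that g_less[of s]
      by (intro continuous_intros continuous_cubic_density_below_edge a) (auto simp del: of_real_diff)
  qed (use a in \<open>auto simp: divide_le_0_iff\<close>)
  with H int show ?thesis
    unfolding interval_integral_minf restrict_cubic_density by (simp only: has_bochner_integral_iff)
qed

section \<open>Assembly of density and atom\<close>

text \<open>The atom, which lies above the edge, is realised by collapsing a piece of Lebesgue measure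
  above the edge.\<close>

definition cubic_law :: "real \<Rightarrow> real \<Rightarrow> real \<Rightarrow> real measure" where
  "cubic_law a b c = distr
     (density lborel (\<lambda>x. ennreal (cubic_density a b c x
        + cubic_atom_mass a b c * indicator {cubic_edge a b c<..<cubic_edge a b c + 1} x)))
     borel (\<lambda>x. if x < cubic_edge a b c then x else cubic_atom a b c)"

lemma emeasure_cubic_law:
  assumes a: "a > 0" and A [measurable]: "A \<in> sets borel"
  shows "emeasure (cubic_law a b c) A
    = emeasure (density lborel (\<lambda>x. ennreal (cubic_density a b c x))) A
      + ennreal (cubic_atom_mass a b c) * emeasure (return borel (cubic_atom a b c)) A"
proof -
  let ?e = "cubic_edge a b c" and ?z = "cubic_atom a b c" and ?p = "cubic_atom_mass a b c"
  let ?f = "\<lambda>x. if x < ?e then x else ?z"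
  have p: "?p \<ge> 0" by (simp add: cubic_atom_mass_eq disc_mass_bounds)
  have [measurable]: "?f -` A \<in> sets borel"
    using measurable_sets[of ?f borel borel A] by simp
  have "emeasure (cubic_law a b c) A = (\<integral>\<^sup>+x. ennreal (cubic_density a b c x + ?p * indicator {?e<..<?e + 1} x)
      * indicator (?f -` A) x \<partial>lborel)"
    unfolding cubic_law_def by (simp add: emeasure_distr emeasure_density)
  also have "\<dots> = (\<integral>\<^sup>+x. ennreal (cubic_density a b c x) * indicator A x
       + (ennreal ?p * indicator A ?z) * indicator {?e<..<?e + 1} x \<partial>lborel)"
    by (intro nn_integral_cong)
       (auto simp: indicator_def cubic_density_above_edge)
  also have "\<dots> = (\<integral>\<^sup>+x. ennreal (cubic_density a b c x) * indicator A x \<partial>lborel) + ennreal ?p * indicator A ?z"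
    by (subst nn_integral_add) (auto simp: nn_integral_cmult)
  finally show ?thesis by (simp add: emeasure_density)
qed

lemma real_distribution_cubic_law:
  assumes a: "a > 0"
  shows "real_distribution (cubic_law a b c)"
proof -
  have "emeasure (density lborel (\<lambda>x. ennreal (cubic_density a b c x))) UNIV = (\<integral>\<^sup>+x. ennreal (cubic_density a b c x) \<partial>lborel)"
    by (simp add: emeasure_density)
  also have "\<dots> = ennreal (1 - cubic_atom_mass a b c)"
    using has_bochner_integral_cubic_density[OF a, of b c] cubic_density_nonneg[OF a]
    by (subst nn_integral_eq_integral) (auto simp: has_bochner_integral_iff)
  finally have "emeasure (cubic_law a b c) UNIV = ennreal (1 - cubic_atom_mass a b c) + ennreal (cubic_atom_mass a b c)"
    by (simp add: emeasure_cubic_law[OF a])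
  also have "\<dots> = 1"
    using disc_mass_bounds[of "cubic_disc a b c"] by (simp add: cubic_atom_mass_eq flip: ennreal_plus)
  finally have "prob_space (cubic_law a b c)"
    by (intro prob_spaceI) (simp add: cubic_law_def)
  then show ?thesis by (simp add: real_distribution_def real_distribution_axioms_def cubic_law_def)
qed

text \<open>The atom restores exactly the term subtracted in the resolvent integral of the density,
  so one formula serves all values of \<Delta>.\<close>

lemma cauchy_transform_cubic_law:
  fixes z :: complex
  assumes a: "a > 0" and z: "Im z > 0"
  shows "cauchy_transform (cubic_law a b c) z = cubic_G a b c z"
proof -
  let ?e = "cubic_edge a b c" and ?z = "cubic_atom a b c" and ?p = "cubic_atom_mass a b c"
  have p: "?p \<ge> 0" by (simp add: cubic_atom_mass_eq disc_mass_bounds)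
  let ?f = "\<lambda>x. if x < ?e then x else ?z"
  have "cauchy_transform (cubic_law a b c) z
    = (LBINT x. (cubic_density a b c x + ?p * indicator {?e<..<?e + 1} x) *\<^sub>R (1 / (z - of_real (?f x))))"
    unfolding cauchy_transform_def cubic_law_def
    using p cubic_density_nonneg[OF a]
    by (subst integral_distr, measurable) (subst integral_density, auto)
  also have "\<dots> = (LBINT x. cubic_density a b c x *\<^sub>R (1 / (z - of_real x))
      + indicator {?e<..<?e + 1} x *\<^sub>R (?p / (z - of_real ?z)))"
    by (intro Bochner_Integration.integral_cong)
      (auto simp: indicator_def cubic_density_above_edge scaleR_conv_of_real)
  also have "\<dots> = (cubic_G a b c z - ?p / (z - of_real ?z)) + ?p / (z - of_real ?z)"
  proof (rule has_bochner_integral_integral_eq, rule has_bochner_integral_add)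
    show "has_bochner_integral lborel (\<lambda>x. indicator {?e<..<?e + 1} x *\<^sub>R (?p / (z - of_real ?z))) (?p / (z - of_real ?z))"
      using has_bochner_integral_scaleR_left[where c="?p / (z - of_real ?z)",
          OF has_bochner_integral_real_indicator[of "{?e<..<?e + 1}" lborel]]
      by simp
  qed (rule has_bochner_integral_cubic_density_resolvent[OF a z])
  finally show ?thesis by simp
qed

subsection \<open>Free convolution\<close>

text \<open>Solving (w + 1)^2 - \<Delta> = 4 a u by w = V - 1, with V the square root of \<Delta> +
  4 a u, and inserting w into z = e + w^2/(4a) gives this expression for z - u.\<close>

definition cubic_phi :: "real \<Rightarrow> real \<Rightarrow> real \<Rightarrow> complex \<Rightarrow> complex" where
  "cubic_phi a b c u = (- of_real b - csqrt (of_real (cubic_disc a b c) + 4 * of_real a * u)) / (2 * of_real a)"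

lemma recip_cauchy_cubic_law:
  fixes z :: complex
  assumes "a > 0" "Im z > 0"
  shows "recip_cauchy (cubic_law a b c) z = ((cubic_sqrt a b c z + 1)\<^sup>2 - of_real (cubic_disc a b c)) / (4 * of_real a)"
  by (simp add: recip_cauchy_def cauchy_transform_cubic_law[OF assms] cubic_G_def)

text \<open>1/G depends on z only through (w + 1)^2. Squaring is injective on the right half-plane,
  which contains w + 1, and w^2 determines z.\<close>

lemma inj_on_recip_cauchy_cubic_law:
  assumes a: "a > 0"
  shows "inj_on (recip_cauchy (cubic_law a b c)) {z. Im z > 0}"
proof (rule inj_onI, simp only: mem_Collect_eq)
  fix x y assume xy: "Im x > 0" "Im y > 0"
    and eq: "recip_cauchy (cubic_law a b c) x = recip_cauchy (cubic_law a b c) y"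
  have "(cubic_sqrt a b c x + 1)\<^sup>2 = (cubic_sqrt a b c y + 1)\<^sup>2"
    using eq a unfolding recip_cauchy_cubic_law[OF a xy(1)] recip_cauchy_cubic_law[OF a xy(2)] by simp
  then consider "cubic_sqrt a b c x = cubic_sqrt a b c y" | "cubic_sqrt a b c x + 1 = - (cubic_sqrt a b c y + 1)"
    unfolding power2_eq_iff by auto
  then have "cubic_sqrt a b c x = cubic_sqrt a b c y"
  proof cases
    case 2
    from arg_cong[OF this, of Re] show ?thesis
      using cubic_sqrt_quadrant(1)[OF a xy(1), of b c] cubic_sqrt_quadrant(1)[OF a xy(2), of b c] by simp
  qed
  then have "(cubic_sqrt a b c x)\<^sup>2 = (cubic_sqrt a b c y)\<^sup>2" by simp
  then show "x = y" using a unfolding cubic_sqrt_sq[OF a] by simp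
qed

text \<open>The assumption Re V > 1 makes V - 1 the principal root of its square, hence the value of
  \<open>cubic_sqrt\<close> at the proposed preimage.\<close>

lemma recip_cauchy_cubic_phi:
  assumes a: "a > 0"
    and v: "Re (csqrt (of_real (cubic_disc a b c) + 4 * of_real a * u)) > 1"
    and z: "Im (u + cubic_phi a b c u) > 0"
  shows "recip_cauchy (cubic_law a b c) (u + cubic_phi a b c u) = u"
proof -
  define V where "V = csqrt (of_real (cubic_disc a b c) + 4 * of_real a * u)"
  have V2: "V\<^sup>2 = of_real (cubic_disc a b c) + 4 * of_real a * u" by (simp add: V_def)
  have D: "of_real (cubic_disc a b c) = (of_real b)\<^sup>2 - 4 * of_real a * complex_of_real c"
    by (simp add: cubic_disc_def)
  have p: "2 * of_real a * cubic_phi a b c u = - of_real b - V" using a by (simp add: cubic_phi_def V_def)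
  have "(of_real b + 1)\<^sup>2 + 4 * of_real a * (u + cubic_phi a b c u - of_real c) = (V - 1)\<^sup>2"
    using p V2 D by algebra
  then have "cubic_sqrt a b c (u + cubic_phi a b c u) = V - 1"
    unfolding cubic_sqrt_def using v V_def by (intro csqrt_unique) auto
  then show ?thesis
    unfolding recip_cauchy_cubic_law[OF a z] using a V2 by simp
qed

text \<open>V grows only like the square root of u, so far out in the cone \<open>cubic_phi\<close>
  is small against Im u. Thus u + \<open>cubic_phi\<close> u stays in a wider cone, where 1/G is
  injective and maps it back to u.\<close>

lemma voiculescu_transform_cubic_law:
  assumes a: "a > 0"
  obtains \<beta>\<^sub>0 where "\<beta>\<^sub>0 > 0" "\<And>\<beta>. \<beta> \<ge> \<beta>\<^sub>0 \<Longrightarrow> voiculescu_transform_on (cubic_law a b c) 1 \<beta> (cubic_phi a b c)"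
proof
  \<comment> \<open>Chosen so that |\<Delta>| + 8 t \<le> (t - |b|)^2 for all t \<ge> K; with t = a
    Im u this bounds |V| by t - |b|.\<close>
  define K where "K = 2 * \<bar>b\<bar> + 8 + \<bar>cubic_disc a b c\<bar>"
  define \<beta>0 where "\<beta>0 = max 2 (K / a)"
  show "\<beta>0 > 0" by (simp add: \<beta>0_def)
  fix \<beta> assume \<beta>: "\<beta> \<ge> \<beta>0"
  let ?F = "recip_cauchy (cubic_law a b c)" and ?C = "trunc_cone 4 1"
  have C: "?C \<subseteq> {z. Im z > 0}" by (auto simp: trunc_cone_def)
  have inj: "inj_on ?F ?C" using inj_on_recip_cauchy_cubic_law[OF a] C by (rule inj_on_subset)
  have key: "u + cubic_phi a b c u \<in> ?C \<and> ?F (u + cubic_phi a b c u) = u" if u: "u \<in> trunc_cone 1 \<beta>" for u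
  proof -
    define y where "y = Im u"
    have y: "y > 2" "\<bar>Re u\<bar> < y" "K \<le> a * y"
    proof -
      have "y > \<beta>0" using u \<beta> by (simp add: trunc_cone_def y_def)
      then have "y > K / a" "y > 2" by (auto simp: \<beta>0_def)
      then show "y > 2" "K \<le> a * y" using a by (auto simp: field_simps)
      show "\<bar>Re u\<bar> < y" using u by (simp add: trunc_cone_def y_def)
    qed
    define V where "V = csqrt (of_real (cubic_disc a b c) + 4 * of_real a * u)"
    have V2: "V\<^sup>2 = of_real (cubic_disc a b c) + 4 * of_real a * u" by (simp add: V_def)
    have "cmod u \<le> \<bar>Re u\<bar> + \<bar>Im u\<bar>" by (rule cmod_le)
    then have "cmod u \<le> 2 * y" using y by (simp add: y_def)
    then have "4 * a * cmod u \<le> 8 * (a * y)" using a by simp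
    moreover have "(cmod V)\<^sup>2 \<le> \<bar>cubic_disc a b c\<bar> + 4 * a * cmod u"
      unfolding norm_power[symmetric] V2
      using norm_triangle_ineq[of "of_real (cubic_disc a b c)" "4 * of_real a * u"] a by (simp add: norm_mult)
    ultimately have "(cmod V)\<^sup>2 \<le> \<bar>cubic_disc a b c\<bar> + 8 * (a * y)" by simp
    also have "\<dots> \<le> (a * y - \<bar>b\<bar>)\<^sup>2"
    proof -
      define t where "t = a * y"
      have t: "t \<ge> K" "t \<ge> 1" using y by (auto simp: t_def K_def)
      have "t * K \<le> t * t" using t by (intro mult_left_mono) auto
      moreover have "\<bar>cubic_disc a b c\<bar> \<le> t * \<bar>cubic_disc a b c\<bar>" using t by (simp add: mult_le_cancel_right1)
      ultimately have "\<bar>cubic_disc a b c\<bar> + 8 * t + 2 * \<bar>b\<bar> * t \<le> t * t"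
        by (simp add: K_def algebra_simps)
      moreover have "(t - \<bar>b\<bar>)\<^sup>2 = t * t - 2 * \<bar>b\<bar> * t + b\<^sup>2" by (simp add: power2_eq_square algebra_simps)
      ultimately show ?thesis unfolding t_def[symmetric] using zero_le_power2[of b] by linarith
    qed
    finally have "(cmod V)\<^sup>2 \<le> (a * y - \<bar>b\<bar>)\<^sup>2" .
    moreover have "0 \<le> a * y - \<bar>b\<bar>"
      using y(3) abs_ge_zero[of b] abs_ge_zero[of "cubic_disc a b c"] unfolding K_def by linarith
    ultimately have V: "cmod V \<le> a * y - \<bar>b\<bar>" by (rule power2_le_imp_le)
    \<comment> \<open>From Re V Im V = 2 a y and Im V \<le> a y it follows that Re V \<ge>
      2.\<close>
    have "2 * Re V * Im V = Im (V\<^sup>2)" by (simp add: power2_eq_square)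
    also have "\<dots> = 4 * (a * y)" unfolding V2 by (simp add: y_def)
    finally have prod: "Re V * Im V = 2 * (a * y)" by (simp add: mult.commute)
    have ay: "a * y > 0" using a y by simp
    have ReV: "Re V \<ge> 0" using csqrt_principal[of "of_real (cubic_disc a b c) + 4 * of_real a * u"]
      by (auto simp: V_def)
    have "Im V \<le> a * y" using abs_Im_le_cmod[of V] V by linarith
    then have "Re V * Im V \<le> Re V * (a * y)" using ReV by (rule mult_left_mono)
    then have "2 * (a * y) \<le> Re V * (a * y)" using prod by simp
    then have "2 \<le> Re V" using ay by (rule mult_right_le_imp_le)
    then have "Re V > 1" by simp
    have "cmod (cubic_phi a b c u) \<le> (\<bar>b\<bar> + cmod V) / (2 * a)"
    proof -
      have "cmod (- of_real b - V) \<le> \<bar>b\<bar> + cmod V"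
        using norm_triangle_ineq4[of "- of_real b" V] by simp
      then show ?thesis using a by (simp add: cubic_phi_def V_def norm_divide norm_mult divide_right_mono)
    qed
    also have "\<dots> \<le> (a * y) / (2 * a)" using V a by (intro divide_right_mono) auto
    finally have phi: "cmod (cubic_phi a b c u) \<le> y / 2" using a by simp
    have "\<bar>Re (cubic_phi a b c u)\<bar> \<le> y / 2" "\<bar>Im (cubic_phi a b c u)\<bar> \<le> y / 2"
      using phi abs_Re_le_cmod[of "cubic_phi a b c u"] abs_Im_le_cmod[of "cubic_phi a b c u"] by linarith+
    moreover from this have "- (y / 2) \<le> Im (cubic_phi a b c u)" by (simp add: abs_le_iff)
    moreover have "\<bar>Re u + Re (cubic_phi a b c u)\<bar> \<le> \<bar>Re u\<bar> + \<bar>Re (cubic_phi a b c u)\<bar>"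
      by (rule abs_triangle_ineq)
    \<comment> \<open>With |\<open>cubic_phi\<close>| \<le> y/2 and y > 2, the imaginary part is at
      least y/2 > 1 and the real part stays below 3y/2 in modulus, so a cone of aperture 4
      suffices.\<close>
    ultimately have "1 < y + Im (cubic_phi a b c u)"
        "\<bar>Re u + Re (cubic_phi a b c u)\<bar> < 4 * (y + Im (cubic_phi a b c u))"
      using y by (simp_all add: field_simps)
    then have mem: "u + cubic_phi a b c u \<in> ?C" by (simp add: trunc_cone_def y_def[symmetric])
    with recip_cauchy_cubic_phi[OF a, of b c u] \<open>Re V > 1\<close> C show ?thesis by (auto simp: V_def)
  qed
  have "trunc_cone 1 \<beta> \<subseteq> ?F ` ?C" using key by (metis image_eqI subsetI)
  moreover have "cubic_phi a b c u = the_inv_into ?C ?F u - u" if "u \<in> trunc_cone 1 \<beta>" for u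
    using the_inv_into_f_eq[OF inj, of "u + cubic_phi a b c u" u] key[OF that] by simp
  ultimately show "voiculescu_transform_on (cubic_law a b c) 1 \<beta> (cubic_phi a b c)"
    unfolding voiculescu_transform_on_def using inj by (intro exI[of _ 4] exI[of _ 1] conjI ballI) auto
qed

section \<open>Convolution roots by scaling\<close>

text \<open>Both \<Delta> and a acquire the factor 1/t^2, so the square root and b acquire 1/t, and
  the denominator a/t^2 leaves t. Positivity of t keeps the root principal.\<close>

lemma cubic_phi_scale:
  assumes "a > 0" "t > 0"
  shows "cubic_phi (a / t\<^sup>2) (b / t) c u = of_real t * cubic_phi a b c u"
proof -
  define X where "X = of_real (cubic_disc a b c) + 4 * of_real a * u"
  have "of_real (cubic_disc (a / t\<^sup>2) (b / t) c) + 4 * of_real (a / t\<^sup>2) * u = (csqrt X / of_real t)\<^sup>2"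
    using assms by (simp add: power_divide X_def cubic_disc_def add_divide_distrib diff_divide_distrib)
  moreover have "csqrt ((csqrt X / of_real t)\<^sup>2) = csqrt X / of_real t"
    using csqrt_principal[of X] assms by (intro csqrt_square) (auto simp: Re_divide_of_real Im_divide_of_real)
  ultimately have root: "csqrt (of_real (cubic_disc (a / t\<^sup>2) (b / t) c) + 4 * of_real (a / t\<^sup>2) * u) = csqrt X / of_real t"
    by (simp only:)
  show ?thesis
    unfolding cubic_phi_def root X_def[symmetric]
    using assms by (simp add: power2_eq_square field_simps)
qed

text \<open>The three Voiculescu transforms are s, t and s + t times one function. They are compared
  on one cone, above the largest of the three thresholds.\<close>

lemma free_convolution_cubic_law:
  assumes a: "a > 0" and st: "s > 0" "t > 0"
  shows "is_free_convolution (cubic_law (a / s\<^sup>2) (b / s) c) (cubic_law (a / t\<^sup>2) (b / t) c)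
    (cubic_law (a / (s + t)\<^sup>2) (b / (s + t)) c)"
proof -
  have pos: "a / r\<^sup>2 > 0" if "r > 0" for r using a that by simp
  obtain \<beta>1 where \<beta>1: "\<beta>1 > 0" "\<And>\<beta>. \<beta> \<ge> \<beta>1 \<Longrightarrow>
      voiculescu_transform_on (cubic_law (a / s\<^sup>2) (b / s) c) 1 \<beta> (cubic_phi (a / s\<^sup>2) (b / s) c)"
    using voiculescu_transform_cubic_law[OF pos[OF st(1)]] by blast
  obtain \<beta>2 where \<beta>2: "\<And>\<beta>. \<beta> \<ge> \<beta>2 \<Longrightarrow>
      voiculescu_transform_on (cubic_law (a / t\<^sup>2) (b / t) c) 1 \<beta> (cubic_phi (a / t\<^sup>2) (b / t) c)"
    using voiculescu_transform_cubic_law[OF pos[OF st(2)]] by blast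
  have st': "s + t > 0" using st by simp
  obtain \<beta>3 where \<beta>3: "\<And>\<beta>. \<beta> \<ge> \<beta>3 \<Longrightarrow>
      voiculescu_transform_on (cubic_law (a / (s + t)\<^sup>2) (b / (s + t)) c) 1 \<beta> (cubic_phi (a / (s + t)\<^sup>2) (b / (s + t)) c)"
    using voiculescu_transform_cubic_law[OF pos[OF st']] by blast
  have phi: "cubic_phi (a / (s + t)\<^sup>2) (b / (s + t)) c
      = (\<lambda>z. cubic_phi (a / s\<^sup>2) (b / s) c z + cubic_phi (a / t\<^sup>2) (b / t) c z)"
    using cubic_phi_scale[OF a st(1)] cubic_phi_scale[OF a st(2)] cubic_phi_scale[OF a st']
    by (simp add: fun_eq_iff algebra_simps)
  define \<beta> where "\<beta> = max \<beta>1 (max \<beta>2 \<beta>3)"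
  have \<beta>: "\<beta> > 0" "\<beta> \<ge> \<beta>1" "\<beta> \<ge> \<beta>2" "\<beta> \<ge> \<beta>3" using \<beta>1(1) by (auto simp: \<beta>_def)
  show ?thesis
    unfolding is_free_convolution_def
  proof (intro conjI real_distribution_cubic_law pos st st' exI)
    show "0 < (1::real)" by simp
    show "0 < \<beta>" by (rule \<beta>(1))
    show "voiculescu_transform_on (cubic_law (a / s\<^sup>2) (b / s) c) 1 \<beta> (cubic_phi (a / s\<^sup>2) (b / s) c)"
      by (rule \<beta>1(2)[OF \<beta>(2)])
    show "voiculescu_transform_on (cubic_law (a / t\<^sup>2) (b / t) c) 1 \<beta> (cubic_phi (a / t\<^sup>2) (b / t) c)"
      by (rule \<beta>2[OF \<beta>(3)])
    show "voiculescu_transform_on (cubic_law (a / (s + t)\<^sup>2) (b / (s + t)) c) 1 \<beta>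
        (\<lambda>z. cubic_phi (a / s\<^sup>2) (b / s) c z + cubic_phi (a / t\<^sup>2) (b / t) c z)"
      using \<beta>3[OF \<beta>(4)] by (simp only: phi)
  qed
qed

lemma is_free_power_cubic_law:
  assumes a: "a > 0" and s: "s > 0" and n: "n \<ge> 1"
  shows "is_free_power (cubic_law (a / s\<^sup>2) (b / s) c) n (cubic_law (a / (n * s)\<^sup>2) (b / (n * s)) c)"
  using n
proof (induction n rule: nat_induct_at_least)
  case base
  have "real_distribution (cubic_law (a / s\<^sup>2) (b / s) c)" using a s by (intro real_distribution_cubic_law) simp
  then show ?case using is_free_power.one by simp
next
  case (Suc n)
  have "real n * s > 0" using Suc.hyps s by simp
  from free_convolution_cubic_law[OF a this s, of b c]
  have "is_free_convolution (cubic_law (a / (n * s)\<^sup>2) (b / (n * s)) c) (cubic_law (a / s\<^sup>2) (b / s) c)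
    (cubic_law (a / (Suc n * s)\<^sup>2) (b / (Suc n * s)) c)"
    by (simp add: algebra_simps)
  with Suc.IH show ?case by (rule is_free_power.step)
qed

lemma freely_infinitely_divisible_cubic_law:
  assumes a: "a > 0"
  shows "freely_infinitely_divisible (cubic_law a b c)"
  unfolding freely_infinitely_divisible_def
proof (intro allI impI)
  fix n :: nat assume n: "n \<ge> 1"
  \<comment> \<open>The root of order n has the parameters a n^2, b n and c.\<close>
  define s where "s = 1 / real n"
  have s: "s > 0" "real n * s = 1" using n by (auto simp: s_def)
  have "is_free_power (cubic_law (a / s\<^sup>2) (b / s) c) n (cubic_law a b c)"
    using is_free_power_cubic_law[OF a s(1) n, of b c] s(2) by simp
  moreover have "real_distribution (cubic_law (a / s\<^sup>2) (b / s) c)"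
    using a s by (intro real_distribution_cubic_law) simp
  ultimately show "\<exists>\<mu>. real_distribution \<mu> \<and> is_free_power \<mu> n (cubic_law a b c)" by blast
qed

subsection \<open>Support\<close>

text \<open>Countably many null sets from a base of the topology cover the complement of the
  support.\<close>

lemma (in real_distribution) AE_in_msupp: "AE x in M. x \<in> msupp M"
proof -
  obtain \<B> :: "real set set" where \<B>: "countable \<B>" "topological_basis \<B>"
    using ex_countable_basis by blast
  let ?N = "{b \<in> \<B>. emeasure M b = 0}"
  have "(\<Union>b\<in>?N. b) \<in> null_sets M"
  proof (rule null_sets_UN')
    show "countable ?N" using \<B>(1) by (rule countable_subset[rotated]) auto
    show "b \<in> null_sets M" if "b \<in> ?N" for b
      using that topological_basis_open[OF \<B>(2), of b] by (auto simp: null_sets_def)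
  qed
  moreover have "{x \<in> space M. x \<notin> msupp M} \<subseteq> (\<Union>b\<in>?N. b)"
  proof clarify
    fix x assume "x \<notin> msupp M"
    then obtain U where U: "open U" "x \<in> U" "emeasure M U = 0"
      by (auto simp: msupp_def)
    then obtain b where b: "b \<in> \<B>" "x \<in> b" "b \<subseteq> U"
      using \<B>(2) by (metis topological_basisE)
    have "emeasure M b \<le> emeasure M U" using b U by (intro emeasure_mono) auto
    then show "x \<in> (\<Union>b\<in>?N. b)" using b U by auto
  qed
  ultimately show ?thesis by (rule AE_I')
qed

lemma (in real_distribution) msupp_nonempty: "msupp M \<noteq> {}"
  using AE_in_msupp by (auto simp: AE_False)

lemma (in real_distribution) AE_le_csk_B:
  assumes "bdd_above (msupp M)"
  shows "AE x in M. x \<le> csk_B M"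
  using AE_in_msupp
proof eventually_elim
  case (elim x)
  then have "x \<le> Sup (msupp M)" using assms by (rule cSup_upper)
  then show ?case by (simp add: csk_B_def)
qed

lemma (in real_distribution) eq_return_borel:
  assumes "AE x in M. x = m"
  shows "M = return borel m"
proof (rule measure_eqI)
  fix A assume A: "A \<in> sets M"
  have "emeasure M A = (\<integral>\<^sup>+x. indicator A x \<partial>M)" using A by simp
  also have "\<dots> = (\<integral>\<^sup>+x. indicator A m \<partial>M)"
    using assms by (intro nn_integral_cong_AE) auto
  also have "\<dots> = indicator A m" using emeasure_space_1 by simp
  finally show "emeasure M A = emeasure (return borel m) A" using A by simp
qed simp

section \<open>The right end of the support of the explicit law\<close>

definition cubic_sup :: "real \<Rightarrow> real \<Rightarrow> real \<Rightarrow> real" where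
  "cubic_sup a b c = (if cubic_disc a b c > 1 then cubic_atom a b c else cubic_edge a b c)"

lemma cubic_edge_le_sup:
  assumes a: "a > 0"
  shows "cubic_edge a b c \<le> cubic_sup a b c"
proof (cases "cubic_disc a b c > 1")
  case True
  then have "0 \<le> 4 * a * (cubic_atom a b c - cubic_edge a b c)"
    using cubic_atom_conv_edge[OF a, of b c] by simp
  then show ?thesis using True a by (simp add: cubic_sup_def zero_le_mult_iff)
qed (simp add: cubic_sup_def)

text \<open>Beyond \<open>cubic_sup\<close> there is no mass. The value is attained by the atom if
  \<Delta> > 1, and otherwise approached by points below the edge, where the density is
  positive.\<close>

lemma Sup_msupp_cubic_law:
  assumes a: "a > 0" and bdd: "bdd_above (msupp (cubic_law a b c))"
  shows "Sup (msupp (cubic_law a b c)) = cubic_sup a b c"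
    (is "Sup ?S = ?s")
proof (rule antisym)
  interpret real_distribution "cubic_law a b c" by (rule real_distribution_cubic_law[OF a])
  have edge_le: "cubic_edge a b c \<le> ?s" by (rule cubic_edge_le_sup[OF a])
  show "Sup ?S \<le> ?s"
  proof (rule cSup_least[OF msupp_nonempty])
    fix x assume x: "x \<in> ?S"
    show "x \<le> ?s"
    proof (rule ccontr)
      assume "\<not> x \<le> ?s"
      then have "emeasure (cubic_law a b c) {?s<..} > 0" using x by (auto simp: msupp_def)
      moreover have "emeasure (cubic_law a b c) {?s<..} = 0"
      proof -
        have "ennreal (cubic_density a b c x) * indicator {?s<..} x = 0" for x
          using edge_le by (cases "x > ?s") (auto simp: cubic_density_above_edge)
        then have 1: "emeasure (density lborel (\<lambda>x. ennreal (cubic_density a b c x))) {?s<..} = 0"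
          by (subst emeasure_density) (simp_all only:, auto)
        have 2: "ennreal (cubic_atom_mass a b c) * emeasure (return borel (cubic_atom a b c)) {?s<..} = 0"
          by (auto simp: cubic_atom_mass_eq disc_mass_def cubic_sup_def)
        have "{?s<..} \<in> sets borel" by simp
        from emeasure_cubic_law[OF a this, of b c] show ?thesis unfolding 1 2 by simp
      qed
      ultimately show False by simp
    qed
  qed
  show "?s \<le> Sup ?S"
  proof (cases "cubic_disc a b c > 1")
    case True
    have "cubic_atom_mass a b c > 0" using True by (simp add: cubic_atom_mass_eq disc_mass_def)
    then have "cubic_atom a b c \<in> ?S"
      by (auto simp: msupp_def emeasure_cubic_law[OF a] add_nonneg_pos)
    then show ?thesis using True bdd by (simp add: cSup_upper cubic_sup_def)
  next
    case False
    have "x \<le> Sup ?S" if x: "x < cubic_edge a b c" for x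
    proof (rule cSup_upper[OF _ bdd])
      \<comment> \<open>A null neighbourhood would force the positive density to vanish almost
        everywhere on an interval of positive length.\<close>
      have "emeasure (density lborel (\<lambda>x. ennreal (cubic_density a b c x))) U > 0" if U: "open U" "x \<in> U" for U
      proof -
        have "open (U \<inter> {..<cubic_edge a b c})" "x \<in> U \<inter> {..<cubic_edge a b c}" using U x by auto
        then obtain d where d: "d > 0" "{x - d<..<x + d} \<subseteq> U \<inter> {..<cubic_edge a b c}" unfolding ball_eq_greaterThanLessThan[symmetric] by (meson openE)
        have "\<not> (AE y in lborel. y \<notin> {x - d<..<x + d})"
        proof
          assume "AE y in lborel. y \<notin> {x - d<..<x + d}"
          then have "emeasure lborel ({x - d<..<x + d}) = 0"
            by (subst (asm) AE_iff_measurable[of "{x - d<..<x + d}"]) auto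
          then show False using d(1) by simp
        qed
        moreover have "AE y in lborel. y \<notin> {x - d<..<x + d}"
          if "emeasure (density lborel (\<lambda>x. ennreal (cubic_density a b c x))) U = 0"
        proof -
          have "AE y in lborel. ennreal (cubic_density a b c y) * indicator U y = 0"
            using that U by (simp add: emeasure_density nn_integral_0_iff_AE)
          then show ?thesis
          proof eventually_elim
            case (elim y)
            then show ?case using d(2) cubic_density_pos[OF a, of y b c] by (auto simp: indicator_def split: if_splits)
          qed
        qed
        ultimately show ?thesis by (auto simp: zero_less_iff_neq_zero)
      qed
      then show "x \<in> ?S" by (auto simp: msupp_def emeasure_cubic_law[OF a] add_pos_nonneg)
    qed
    then show ?thesis using False by (auto intro: dense_le simp: cubic_sup_def)
  qed
qed

subsection \<open>Measures on a half-line\<close>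

definition slit_plane :: "real \<Rightarrow> complex set" where
  "slit_plane B = {z. Im z \<noteq> 0} \<union> {z. Re z > B}"

lemma open_slit_plane: "open (slit_plane B)"
  unfolding slit_plane_def by (intro open_Un open_halfspace_Re_gt open_Collect_neq continuous_intros)

lemma connected_slit_plane: "connected (slit_plane B)"
proof (rule starlike_imp_connected, unfold starlike_def, intro bexI ballI subsetI)
  show "of_real (B + 1) \<in> slit_plane B" by (simp add: slit_plane_def)
  fix z w assume z: "z \<in> slit_plane B" and w: "w \<in> closed_segment (of_real (B + 1)) z"
  then obtain u where u: "0 \<le> u" "u \<le> 1" "w = (1 - u) *\<^sub>R of_real (B + 1) + u *\<^sub>R z"
    by (auto simp: in_segment)
  show "w \<in> slit_plane B"
  proof (cases "u = 0")
    case False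
    consider "Im z \<noteq> 0" | "Re z > B" using z by (auto simp: slit_plane_def)
    then show ?thesis
    proof cases
      case 1
      then show ?thesis using u False by (simp add: slit_plane_def)
    next
      case 2
      have "Re w = (1 - u) * (B + 1) + u * Re z" using u by simp
      moreover have "u * Re z > u * B" using 2 u False by simp
      moreover have "(1 - u) * (B + 1) \<ge> (1 - u) * B" using u by (intro mult_left_mono) auto
      ultimately have "Re w > (1 - u) * B + u * B" by linarith
      then show ?thesis by (simp add: slit_plane_def algebra_simps)
    qed
  qed (use u in \<open>simp add: slit_plane_def\<close>)
qed

lemma slit_plane_distance:
  assumes "z \<in> slit_plane B"
  obtains d where "d > 0" "\<And>x. x \<le> B \<Longrightarrow> d \<le> cmod (z - of_real x)"
proof (cases "Im z = 0")
  case True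
  then have "Re z > B" using assms by (simp add: slit_plane_def)
  moreover have "Re z - B \<le> cmod (z - of_real x)" if "x \<le> B" for x
    using complex_Re_le_cmod[of "z - of_real x"] that by simp
  ultimately show ?thesis using that[of "Re z - B"] by simp
next
  case False
  then show ?thesis using that[of "\<bar>Im z\<bar>"] cmod_diff_of_real_ge_Im[of z] by simp
qed

lemma norm_integral_le_AE:
  fixes f :: "'a \<Rightarrow> 'b :: {banach, second_countable_topology}"
  assumes "integrable M f" "integrable M g" "AE x in M. norm (f x) \<le> g x"
  shows "norm (integral\<^sup>L M f) \<le> integral\<^sup>L M g"
  using order_trans[OF integral_norm_bound[of M f] integral_mono_AE[of M "\<lambda>x. norm (f x)" g]] assms by simp

section \<open>Holomorphy of the Cauchy transform off a half-line\<close>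

locale law_on_half_line = real_distribution +
  fixes B :: real
  assumes AE_le: "AE x in M. x \<le> B"
begin

lemma integrable_resolvent:
  assumes "z \<in> slit_plane B"
  shows "integrable M (\<lambda>x. 1 / (z - complex_of_real x))"
proof -
  obtain d where d: "d > 0" "\<And>x. x \<le> B \<Longrightarrow> d \<le> cmod (z - of_real x)"
    using slit_plane_distance[OF assms] by blast
  show ?thesis
  proof (rule integrable_const_bound[where B="1 / d"])
    show "AE x in M. cmod (1 / (z - complex_of_real x)) \<le> 1 / d"
      using AE_le by eventually_elim (use d in \<open>auto simp: norm_divide intro!: frac_le\<close>)
  qed auto
qed

text \<open>Differentiation under the integral. With p = w - x and q = z - x the difference quotient
  of the kernel deviates from its derivative by (p - q)/(p q^2), at most 2 |w - z| / d^3 uniformly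
  in x, where d bounds the distance from z to the half-line from below.\<close>

lemma holomorphic_cauchy_transform: "cauchy_transform M holomorphic_on slit_plane B"
proof (subst holomorphic_on_open[OF open_slit_plane], intro ballI exI)
  fix z assume z: "z \<in> slit_plane B"
  obtain d where d: "d > 0" "\<And>x. x \<le> B \<Longrightarrow> d \<le> cmod (z - of_real x)"
    using slit_plane_distance[OF z] by blast
  define D where "D = (\<integral>x. - 1 / (z - of_real x)\<^sup>2 \<partial>M)"
  have intD: "integrable M (\<lambda>x. - 1 / (z - of_real x)\<^sup>2)"
  proof (rule integrable_const_bound[where B="1 / d\<^sup>2"])
    show "AE x in M. cmod (- 1 / (z - of_real x)\<^sup>2) \<le> 1 / d\<^sup>2"
      using AE_le by eventually_elim (use d in \<open>auto simp: norm_divide norm_power intro!: frac_le power_mono\<close>)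
  qed auto
  have bound: "cmod ((cauchy_transform M w - cauchy_transform M z) / (w - z) - D) \<le> cmod (w - z) * (2 / d ^ 3)"
    if w: "dist w z < d / 2" "w \<noteq> z" "w \<in> slit_plane B" for w
  proof -
    have dw: "d / 2 \<le> cmod (w - of_real x)" if "x \<le> B" for x
    proof -
      have "cmod (z - of_real x) \<le> cmod (w - of_real x) + cmod (w - z)"
        using norm_triangle_ineq4[of "w - of_real x" "w - z"] by simp
      then show ?thesis using d(2)[OF that] w(1) by (simp add: dist_norm)
    qed
    have "(cauchy_transform M w - cauchy_transform M z) / (w - z) - D
      = (\<integral>x. (1 / (w - of_real x) - 1 / (z - of_real x)) / (w - z) - (- 1 / (z - of_real x)\<^sup>2) \<partial>M)"
      unfolding D_def cauchy_transform_def
      using integrable_resolvent[OF z] integrable_resolvent[OF w(3)] intD by simp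
    also have "cmod \<dots> \<le> cmod (w - z) * (2 / d ^ 3)"
    proof -
      have "AE x in M. cmod ((1 / (w - of_real x) - 1 / (z - of_real x)) / (w - z) - (- 1 / (z - of_real x)\<^sup>2))
          \<le> cmod (w - z) * (2 / d ^ 3)"
        using AE_le
      proof eventually_elim
        case (elim x)
        define p q where "p = w - of_real x" and "q = z - of_real x"
        have pq: "d / 2 \<le> cmod p" "d \<le> cmod q" using dw[OF elim] d(2)[OF elim] by (auto simp: p_def q_def)
        then have nz: "p \<noteq> 0" "q \<noteq> 0" "p - q \<noteq> 0" using d(1) w(2) by (auto simp: p_def q_def)
        have "(1 / p - 1 / q) / (p - q) - (- 1 / q\<^sup>2) = (p - q) / (p * q\<^sup>2)"
        proof -
          have "(1 / p - 1 / q) = (p - q) * (- 1 / (p * q))" using nz by (simp add: field_simps)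
          then have "(1 / p - 1 / q) / (p - q) = - 1 / (p * q)" using nz by simp
          then show ?thesis using nz by (simp add: field_simps power2_eq_square)
        qed
        then have "(1 / (w - of_real x) - 1 / (z - of_real x)) / (w - z) - (- 1 / (z - of_real x)\<^sup>2) = (w - z) / (p * q\<^sup>2)"
          by (simp add: p_def q_def)
        also have "cmod \<dots> = cmod (w - z) / (cmod p * (cmod q)\<^sup>2)" by (simp add: norm_divide norm_mult norm_power)
        also have "\<dots> \<le> cmod (w - z) / (d / 2 * d\<^sup>2)"
          using pq d(1) by (intro divide_left_mono mult_mono power_mono mult_pos_pos) (auto intro: nz)
        also have "\<dots> = cmod (w - z) * (2 / d ^ 3)" by (simp add: power3_eq_cube power2_eq_square)
        finally show ?case .
      qed
      then have "norm (\<integral>x. (1 / (w - of_real x) - 1 / (z - of_real x)) / (w - z) - (- 1 / (z - of_real x)\<^sup>2) \<partial>M)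
         \<le> (\<integral>x. cmod (w - z) * (2 / d ^ 3) \<partial>M)"
        using integrable_resolvent[OF z] integrable_resolvent[OF w(3)] intD
        by (intro norm_integral_le_AE) auto
      then show ?thesis using prob_space by simp
    qed
    finally show ?thesis .
  qed
  have "((\<lambda>w. cmod (w - z) * (2 / d ^ 3)) \<longlongrightarrow> cmod (z - z) * (2 / d ^ 3)) (at z)"
    by (intro tendsto_intros)
  then have lim: "((\<lambda>w. cmod (w - z) * (2 / d ^ 3)) \<longlongrightarrow> 0) (at z)" by simp
  have "\<forall>\<^sub>F w in at z. w \<in> slit_plane B" by (rule eventually_at_in_open'[OF open_slit_plane z])
  moreover have "\<forall>\<^sub>F w in at z. dist w z < d / 2 \<and> w \<noteq> z"
    using d(1) by (auto simp: eventually_at intro!: exI[of _ "d / 2"])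
  ultimately have "\<forall>\<^sub>F w in at z. cmod ((cauchy_transform M w - cauchy_transform M z) / (w - z) - D) \<le> cmod (w - z) * (2 / d ^ 3)"
    by eventually_elim (use bound in auto)
  from Lim_null_comparison[OF this lim]
  show "(cauchy_transform M has_field_derivative D) (at z)"
    unfolding has_field_derivative_iff by (rule LIM_zero_cancel)
qed

section \<open>Means of the kernel family\<close>

definition real_cauchy :: "real \<Rightarrow> real" where
  "real_cauchy z = (\<integral>x. 1 / (z - x) \<partial>M)"

definition kernel_mean :: "real \<Rightarrow> real" where
  "kernel_mean z = z - 1 / real_cauchy z"

lemma cauchy_transform_of_real: "cauchy_transform M (of_real z) = of_real (real_cauchy z)"
proof -
  have "cauchy_transform M (of_real z) = (\<integral>x. of_real (1 / (z - x)) \<partial>M)"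
    unfolding cauchy_transform_def by simp
  then show ?thesis unfolding real_cauchy_def integral_complex_of_real .
qed

lemma integrable_real_resolvent:
  assumes "z > B"
  shows "integrable M (\<lambda>x. 1 / (z - x))"
proof -
  have "integrable M (\<lambda>x. Re (1 / (of_real z - of_real x)))"
    using assms by (intro integrable_Re integrable_resolvent) (simp add: slit_plane_def)
  moreover have "Re (1 / (of_real z - of_real x)) = 1 / (z - x)" for x
    by (metis Re_complex_of_real of_real_1 of_real_diff of_real_divide)
  ultimately show ?thesis by simp
qed

lemma real_cauchy_pos:
  assumes "z > B"
  shows "real_cauchy z > 0"
proof -
  have pos: "AE x in M. 1 / (z - x) > 0"
    using AE_le by eventually_elim (use assms in auto)
  then have nn: "AE x in M. 0 \<le> 1 / (z - x)" by eventually_elim simp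
  have "real_cauchy z \<noteq> 0"
  proof
    assume "real_cauchy z = 0"
    then have "AE x in M. 1 / (z - x) = 0"
      unfolding real_cauchy_def
      using integral_nonneg_eq_0_iff_AE[OF integrable_real_resolvent[OF assms] nn] by simp
    with pos have "AE x in M. False" by eventually_elim simp
    then show False by (simp add: AE_False)
  qed
  moreover have "real_cauchy z \<ge> 0" unfolding real_cauchy_def using nn by (rule integral_nonneg_AE)
  ultimately show ?thesis by simp
qed

text \<open>From (x - m)/(z - x) = (z - m)/(z - x) - 1. With m = 0 this computes the mean; if m is
  the mean at z, the integral is zero.\<close>

lemma integral_kernel_numerator:
  assumes "z > B"
  shows "integrable M (\<lambda>x. (x - m) / (z - x))"
    and "(\<integral>x. (x - m) / (z - x) \<partial>M) = (z - m) * real_cauchy z - 1"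
proof -
  have "AE x in M. (z - m) * (1 / (z - x)) - 1 = (x - m) / (z - x)"
    using AE_le by eventually_elim (use assms in \<open>auto simp: field_simps\<close>)
  moreover have "has_bochner_integral M (\<lambda>x. (z - m) * (1 / (z - x)) - 1) ((z - m) * real_cauchy z - 1)"
  proof (intro has_bochner_integral_diff has_bochner_integral_mult_right)
    show "has_bochner_integral M (\<lambda>x. 1 / (z - x)) (real_cauchy z)"
      using integrable_real_resolvent[OF assms] by (simp only: has_bochner_integral_iff real_cauchy_def)
    show "has_bochner_integral M (\<lambda>x. 1) (1::real)"
      using prob_space by (simp add: has_bochner_integral_iff)
  qed
  ultimately have "has_bochner_integral M (\<lambda>x. (x - m) / (z - x)) ((z - m) * real_cauchy z - 1)"
    by (subst (asm) has_bochner_integral_cong_AE) auto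
  then show "integrable M (\<lambda>x. (x - m) / (z - x))"
    "(\<integral>x. (x - m) / (z - x) \<partial>M) = (z - m) * real_cauchy z - 1"
    by (auto simp: has_bochner_integral_iff)
qed

lemma kernel_mean_le:
  assumes "z > B"
  shows "kernel_mean z \<le> B"
proof -
  have "real_cauchy z \<le> (\<integral>x. 1 / (z - B) \<partial>M)"
    unfolding real_cauchy_def
  proof (rule integral_mono_AE)
    show "AE x in M. 1 / (z - x) \<le> 1 / (z - B)"
      using AE_le by eventually_elim (use assms in \<open>auto intro!: frac_le\<close>)
  qed (use integrable_real_resolvent[OF assms] in auto)
  then have "real_cauchy z \<le> 1 / (z - B)" using prob_space by simp
  then have "z - B \<le> 1 / real_cauchy z"
    using real_cauchy_pos[OF assms] assms by (simp add: field_simps)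
  then show ?thesis by (simp add: kernel_mean_def)
qed

text \<open>Equal means \<open>m\<close> at \<open>z\<^sub>1 < z\<^sub>2\<close> force \<open>(x - m)\<^sup>2 / ((z\<^sub>1 - x) (z\<^sub>2 - x))\<close> to have integral \<open>0\<close>.\<close>

lemma inj_on_kernel_mean:
  assumes "nondegenerate M"
  shows "inj_on kernel_mean {B<..}"
proof (rule linorder_inj_onI)
  fix z1 z2 :: real assume "z1 < z2" "z1 \<in> {B<..}" "z2 \<in> {B<..}"
  then have z: "z1 > B" "z2 > B" "z1 < z2" by auto
  show "kernel_mean z1 \<noteq> kernel_mean z2"
  proof
    assume eq: "kernel_mean z1 = kernel_mean z2"
    define m where "m = kernel_mean z1"
    have one: "(z1 - m) * real_cauchy z1 = 1" "(z2 - m) * real_cauchy z2 = 1"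
      using real_cauchy_pos[OF z(1)] real_cauchy_pos[OF z(2)]
      by (simp add: m_def kernel_mean_def, simp only: m_def eq, simp add: kernel_mean_def)
    \<comment> \<open>Each summand has integral zero because m is the mean at both points; the
      weights are such that their difference is a nonnegative multiple of (x - m)^2.\<close>
    define h where "h x = (z1 - m) * ((x - m) / (z1 - x)) - (z2 - m) * ((x - m) / (z2 - x))" for x
    have "has_bochner_integral M h ((z1 - m) * 0 - (z2 - m) * 0)"
      unfolding h_def
      using integral_kernel_numerator[OF z(1), of m] integral_kernel_numerator[OF z(2), of m] one
      by (intro has_bochner_integral_diff has_bochner_integral_mult_right) (simp_all add: has_bochner_integral_iff)
    then have h_int: "integrable M h" "(\<integral>x. h x \<partial>M) = 0" by (simp_all add: has_bochner_integral_iff)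
    have h_eq: "AE x in M. z1 - x > 0 \<and> z2 - x > 0 \<and> h x = (z2 - z1) * (x - m)\<^sup>2 / ((z1 - x) * (z2 - x))"
      using AE_le
    proof eventually_elim
      case (elim x)
      then have "z1 - x > 0" "z2 - x > 0" using z by auto
      then show ?case
        by (simp add: h_def divide_simps) (simp add: algebra_simps power2_eq_square)
    qed
    have "AE x in M. h x \<ge> 0" using h_eq by eventually_elim (use z in auto)
    then have "AE x in M. h x = 0"
      using integral_nonneg_eq_0_iff_AE[OF h_int(1)] h_int(2) by simp
    with h_eq have "AE x in M. x = m" by eventually_elim (use z in auto)
    then have "M = return borel m" by (rule eq_return_borel)
    then show False using assms by (auto simp: nondegenerate_def)
  qed
qed auto

text \<open>At \<theta> = 1/z the kernel 1/(1 - \<theta> x) is z/(z - x), so the factor z cancels in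
  the normalised density and the mean is (z G - 1)/G.\<close>

lemma csk_mean_eq_kernel_mean:
  assumes "z > B" "z > 0"
  shows "csk_mean M (1 / z) = kernel_mean z"
proof -
  note pos = real_cauchy_pos[OF assms(1)]
  \<comment> \<open>At x = z both sides are zero by the convention for division by zero, so the
    identity holds for every x.\<close>
  have inv: "1 / (1 - 1 / z * x) = z * (1 / (z - x))" for x
    using assms(2) by (cases "x = z") (auto simp: field_simps)
  have M: "csk_M M (1 / z) = z * real_cauchy z"
    unfolding csk_M_def inv real_cauchy_def by (rule integral_mult_right_zero)
  have dens: "1 / (csk_M M (1 / z) * (1 - 1 / z * x)) = 1 / real_cauchy z * (1 / (z - x))" for x
    unfolding M using inv[of x] assms(2) by (simp add: divide_inverse mult_ac)
  have "csk_mean M (1 / z) = (\<integral>x. (1 / real_cauchy z * (1 / (z - x))) *\<^sub>R x \<partial>M)"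
    unfolding csk_mean_def csk_P_def dens
  proof (rule integral_density)
    show "AE x in M. 0 \<le> 1 / real_cauchy z * (1 / (z - x))"
      using AE_le by eventually_elim (use assms pos in auto)
  qed auto
  also have "\<dots> = 1 / real_cauchy z * (\<integral>x. (x - 0) / (z - x) \<partial>M)"
    by (subst integral_mult_right_zero[symmetric], intro Bochner_Integration.integral_cong) auto
  also have "\<dots> = kernel_mean z"
    unfolding integral_kernel_numerator(2)[OF assms(1)] using pos by (simp add: kernel_mean_def field_simps)
  finally show ?thesis .
qed

text \<open>For z \<ge> 2B the ratio z/(z - x) is at most 2, so a first moment bounds z (z G - 1) =
  z m G by E. Since (z - m) G = 1, this becomes -m (z - E) \<le> E z, which excludes very negative
  m.\<close>

lemma kernel_mean_bounded_below:
  assumes int: "integrable M (\<lambda>x. x)"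
  obtains C where "\<And>z. z > B \<Longrightarrow> z \<ge> 2 * B \<Longrightarrow> z \<ge> C \<Longrightarrow> kernel_mean z \<ge> - C"
proof -
  define E where "E = 2 * (\<integral>x. \<bar>x\<bar> \<partial>M)"
  have E: "E \<ge> 0" by (simp add: E_def)
  \<comment> \<open>The same constant 2 E + 1 serves as threshold for z and as bound for the
    mean.\<close>
  have "kernel_mean z \<ge> - (2 * E + 1)" if z: "z > B" "z \<ge> 2 * B" "z \<ge> 2 * E + 1" for z
  proof (rule ccontr)
    define m where "m = kernel_mean z"
    assume "\<not> kernel_mean z \<ge> - (2 * E + 1)"
    then have m: "m < - (2 * E + 1)" by (simp add: m_def)
    have z0: "z > 0" using z E by linarith
    have R: "real_cauchy z > 0" by (rule real_cauchy_pos[OF z(1)])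
    have zm: "(z - m) * real_cauchy z = 1" using R by (simp add: m_def kernel_mean_def)
    have "\<bar>\<integral>x. z * ((x - 0) / (z - x)) \<partial>M\<bar> \<le> (\<integral>x. 2 * \<bar>x\<bar> \<partial>M)"
      unfolding real_norm_def[symmetric]
    proof (rule norm_integral_le_AE)
      show "AE x in M. norm (z * ((x - 0) / (z - x))) \<le> 2 * norm x"
        using AE_le
      proof eventually_elim
        case (elim x)
        then have zx: "z - x > 0" "z / 2 \<le> z - x" using z by auto
        have "z / (z - x) \<le> 2" using zx by (simp add: field_simps)
        then have "z / (z - x) * \<bar>x\<bar> \<le> 2 * \<bar>x\<bar>" by (intro mult_right_mono) auto
        then show ?case using zx z0 by (simp add: abs_mult)
      qed
      show "integrable M (\<lambda>x. z * ((x - 0) / (z - x)))"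
        by (rule integrable_mult_right) (rule integral_kernel_numerator(1)[OF z(1)])
      show "integrable M (\<lambda>x. 2 * norm x)"
        by (rule integrable_mult_right) (rule integrable_norm[OF int])
    qed
    then have "\<bar>z * (z * real_cauchy z - 1)\<bar> \<le> E"
      unfolding integral_mult_right_zero integral_kernel_numerator(2)[OF z(1), of 0] by (simp add: E_def)
    moreover have "z * real_cauchy z - 1 = m * real_cauchy z" using zm by (simp add: algebra_simps)
    ultimately have "- (z * m) * real_cauchy z \<le> E" by (simp add: mult.assoc abs_le_iff)
    also have "E = (E * (z - m)) * real_cauchy z" using zm by (simp add: mult.assoc)
    finally have "- (z * m) \<le> E * (z - m)" using R by (rule mult_right_le_imp_le)
    then have le: "(- m) * (z - E) \<le> E * z" by (simp add: algebra_simps)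
    have "(2 * E) * (z - E) < (- m) * (z - E)" using m z E by (intro mult_strict_right_mono) auto
    with le have "2 * E * (z - E) < E * z" by linarith
    then have "E * z < E * (2 * E)" by (simp add: algebra_simps)
    then show False using z E by (simp add: mult_less_cancel_left)
  qed
  then show ?thesis by (rule that)
qed

end

subsection \<open>The kernel family\<close>

text \<open>For B = 0 the upper limit of \<theta> is infinite and z = 1/\<theta> ranges over all
  positive numbers, so the condition z > B covers both cases.\<close>

lemma csk_params_eq: "csk_params M = (\<lambda>z. 1 / z) ` {csk_B M<..}"
proof -
  define B where "B = csk_B M"
  have B: "B \<ge> 0" by (simp add: B_def csk_B_def)
  have iff: "ereal \<theta> < 1 / ereal B \<longleftrightarrow> 1 / \<theta> > B" if "\<theta> > 0" for \<theta>
  proof (cases "B = 0")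
    case True
    then show ?thesis using that by (simp add: divide_ereal_def)
  next
    case False
    then have "B > 0" using B by simp
    then show ?thesis using that by (simp add: one_ereal_def field_simps)
  qed
  show ?thesis
    unfolding csk_params_def theta_plus_def B_def[symmetric]
  proof (intro equalityI subsetI)
    fix \<theta> assume "\<theta> \<in> {\<theta>. 0 < \<theta> \<and> ereal \<theta> < 1 / ereal B}"
    then show "\<theta> \<in> (\<lambda>z. 1 / z) ` {B<..}" using iff[of \<theta>] by (intro image_eqI[of _ _ "1 / \<theta>"]) auto
  next
    fix \<theta> assume "\<theta> \<in> (\<lambda>z. 1 / z) ` {B<..}"
    then obtain z where z: "z > B" "\<theta> = 1 / z" by auto
    then show "\<theta> \<in> {\<theta>. 0 < \<theta> \<and> ereal \<theta> < 1 / ereal B}" using B iff[of \<theta>] by auto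
  qed
qed

section \<open>The explicit mean function and the domain of means\<close>

text \<open>The lower root m of a m^2 + (b + 1) m + c = z.\<close>

definition cubic_mean :: "real \<Rightarrow> real \<Rightarrow> real \<Rightarrow> real \<Rightarrow> real" where
  "cubic_mean a b c z = - (b + 1 + sqrt (4 * a * (z - cubic_edge a b c))) / (2 * a)"

lemma cubic_sqrt_of_real:
  assumes "a > 0" "z \<ge> cubic_edge a b c"
  shows "cubic_sqrt a b c (of_real z) = of_real (sqrt (4 * a * (z - cubic_edge a b c)))"
proof -
  have "(of_real b + 1)\<^sup>2 + 4 * of_real a * (of_real z - of_real c) = complex_of_real (4 * a * (z - cubic_edge a b c))"
    unfolding cubic_sqrt_arg[OF assms(1)] by simp
  then show ?thesis using assms unfolding cubic_sqrt_def by (simp only:) (simp add: csqrt_of_real_nonneg)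
qed

text \<open>On the real axis \<open>cubic_G\<close> is therefore 1/(z - m) with m the explicit mean,
  which links the two descriptions of G.\<close>

lemma cubic_G_denom_of_real:
  assumes "a > 0" "z \<ge> cubic_edge a b c"
  shows "(cubic_sqrt a b c (of_real z) + 1)\<^sup>2 - of_real (cubic_disc a b c) = of_real (4 * a * (z - cubic_mean a b c z))"
proof -
  have "4 * a * (z - cubic_mean a b c z) = 2 * (2 * a * z + b + 1 + sqrt (4 * a * (z - cubic_edge a b c)))"
    using assms by (simp add: cubic_mean_def field_simps)
  then show ?thesis
    using cubic_G_denom[OF assms(1), of b c "of_real z"] unfolding cubic_sqrt_of_real[OF assms] by simp
qed

lemma holomorphic_cubic_sqrt:
  assumes "a > 0" "cubic_edge a b c \<le> B"
  shows "cubic_sqrt a b c holomorphic_on slit_plane B"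
proof -
  have "(of_real b + 1)\<^sup>2 + 4 * of_real a * (z - of_real c) \<notin> \<real>\<^sub>\<le>\<^sub>0" if "z \<in> slit_plane B" for z :: complex
    using that assms unfolding cubic_sqrt_arg[OF assms(1)]
    by (auto simp: slit_plane_def complex_nonpos_Reals_iff mult_le_0_iff)
  then have "(\<lambda>z. csqrt ((of_real b + 1)\<^sup>2 + 4 * of_real a * (z - of_real c))) holomorphic_on slit_plane B"
    by (intro holomorphic_intros) auto
  then show ?thesis by (simp add: cubic_sqrt_def[abs_def])
qed

lemma image_cubic_mean:
  assumes a: "a > 0" and B: "B \<ge> cubic_edge a b c"
  shows "cubic_mean a b c ` {B<..} = {..<cubic_mean a b c B}"
proof (intro equalityI subsetI)
  fix y assume "y \<in> cubic_mean a b c ` {B<..}"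
  then obtain z where z: "z > B" "y = cubic_mean a b c z" by auto
  have "sqrt (4 * a * (B - cubic_edge a b c)) < sqrt (4 * a * (z - cubic_edge a b c))"
    using z a by simp
  then show "y \<in> {..<cubic_mean a b c B}" using a z by (simp add: cubic_mean_def divide_strict_right_mono)
next
  let ?e = "cubic_edge a b c"
  fix y assume "y \<in> {..<cubic_mean a b c B}"
  then have y: "y < cubic_mean a b c B" by simp
  \<comment> \<open>The value that the square root in \<open>cubic_mean\<close> must take to produce
    y; squaring it gives the preimage.\<close>
  define q where "q = - (2 * a * y + b + 1)"
  have "2 * a * y < 2 * a * cubic_mean a b c B" using y a by simp
  also have "\<dots> = - (b + 1 + sqrt (4 * a * (B - ?e)))" using a by (simp add: cubic_mean_def)
  finally have q: "q > sqrt (4 * a * (B - ?e))" by (simp add: q_def)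
  have s0: "sqrt (4 * a * (B - ?e)) \<ge> 0" using a B by simp
  have "(sqrt (4 * a * (B - ?e)))\<^sup>2 < q\<^sup>2" using q s0 by (intro power_strict_mono) auto
  then have less: "4 * a * (B - ?e) < q\<^sup>2" using a B by simp
  define z where "z = ?e + q\<^sup>2 / (4 * a)"
  have zq: "4 * a * (z - ?e) = q\<^sup>2" using a by (simp add: z_def)
  then have "4 * a * (B - ?e) < 4 * a * (z - ?e)" using less by simp
  then have "z > B" using a by simp
  moreover have "cubic_mean a b c z = y"
  proof -
    have "q \<ge> 0" using q s0 by linarith
    then have "sqrt (q\<^sup>2) = q" by simp
    then show ?thesis unfolding cubic_mean_def zq using a by (simp add: q_def)
  qed
  ultimately show "y \<in> cubic_mean a b c ` {B<..}" by auto
qed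

text \<open>The upper end is the lower root at z = B, where B is the edge, the atom and 0 in the
  three cases.\<close>

lemma upper_mean_cases:
  assumes a: "a > 0"
  shows "c > 0 \<Longrightarrow> - sqrt (1 + 4 * a * c) \<le> b \<Longrightarrow> b \<le> 2 * sqrt (a * c) - 1 \<Longrightarrow>
      cubic_mean a b c (max 0 (cubic_sup a b c)) = - (1 + b) / (2 * a)"
    and "c > 0 \<Longrightarrow> b \<le> - sqrt (1 + 4 * a * c) \<Longrightarrow>
      cubic_mean a b c (max 0 (cubic_sup a b c)) = - (b + sqrt (b\<^sup>2 - 4 * a * c)) / (2 * a)"
    and "c \<le> 0 \<or> c > 0 \<and> b > 2 * sqrt (a * c) - 1 \<Longrightarrow>
      cubic_mean a b c (max 0 (cubic_sup a b c)) = - (b + 1 + sqrt ((b + 1)\<^sup>2 - 4 * a * c)) / (2 * a)"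
proof -
  let ?D = "cubic_disc a b c" and ?e = "cubic_edge a b c"
  have D: "?D = b\<^sup>2 - 4 * a * c" by (simp add: cubic_disc_def)
  have e: "4 * a * ?e = 4 * a * c - (b + 1)\<^sup>2" using a by (simp add: cubic_edge_def right_diff_distrib)
  have e_sign: "0 \<le> ?e \<longleftrightarrow> (b + 1)\<^sup>2 \<le> 4 * a * c" "?e \<le> 0 \<longleftrightarrow> 4 * a * c \<le> (b + 1)\<^sup>2"
    using e a zero_le_mult_iff[of "4 * a" ?e] mult_le_0_iff[of "4 * a" ?e] by auto
  {
    assume c: "c > 0" and b: "- sqrt (1 + 4 * a * c) \<le> b" "b \<le> 2 * sqrt (a * c) - 1"
    define r where "r = sqrt (a * c)"
    have r: "r > 0" "r\<^sup>2 = a * c" using a c by (auto simp: r_def)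
    define t where "t = sqrt (1 + 4 * a * c)"
    have t: "t \<ge> 0" "t\<^sup>2 = 1 + 4 * a * c" using a c by (auto simp: t_def)
    \<comment> \<open>The chain 2 r \<le> t \<le> 1 + 2 r turns the bounds on b into |b| \<le> t,
      hence \<Delta> \<le> 1, and |b + 1| \<le> 2 r, hence a nonnegative edge.\<close>
    have "t\<^sup>2 \<le> (1 + 2 * r)\<^sup>2" using t(2) r by (simp add: power2_sum power_mult_distrib)
    then have t_le: "t \<le> 1 + 2 * r" using r(1) by (rule_tac power2_le_imp_le) auto
    have "(2 * r)\<^sup>2 \<le> t\<^sup>2" using t(2) r by (simp add: power_mult_distrib)
    then have "2 * r \<le> t" using t(1) by (rule power2_le_imp_le)
    then have "\<bar>b\<bar> \<le> t" using b by (auto simp: r_def[symmetric] t_def[symmetric])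
    then have "b\<^sup>2 \<le> t\<^sup>2" using abs_le_square_iff[of b t] t(1) by simp
    then have "?D \<le> 1" using t(2) D by simp
    then have S: "cubic_sup a b c = ?e" by (simp add: cubic_sup_def)
    have "\<bar>b + 1\<bar> \<le> 2 * r" using b t_le by (auto simp: r_def[symmetric] t_def[symmetric])
    then have "(b + 1)\<^sup>2 \<le> (2 * r)\<^sup>2" using abs_le_square_iff[of "b + 1" "2 * r"] r(1) by simp
    then have "?e \<ge> 0" unfolding e_sign using r(2) by (simp add: power_mult_distrib)
    then show "cubic_mean a b c (max 0 (cubic_sup a b c)) = - (1 + b) / (2 * a)" by (simp add: S cubic_mean_def)
  next
    assume c: "c > 0" and b: "b \<le> - sqrt (1 + 4 * a * c)"
    define t where "t = sqrt (1 + 4 * a * c)"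
    have t: "t > 0" "t\<^sup>2 = 1 + 4 * a * c" using a c by (auto simp: t_def add_pos_pos)
    have bt: "t \<le> - b" using b by (simp add: t_def)
    then have "t\<^sup>2 \<le> (- b)\<^sup>2" using t(1) by (intro power_mono) auto
    then have D1: "?D \<ge> 1" using t(2) D by simp
    have atom: "4 * a * (cubic_atom a b c - ?e) = (sqrt ?D - 1)\<^sup>2"
      using cubic_atom_conv_edge[OF a] D1 by simp
    \<comment> \<open>At \<Delta> = 1 the atom has no mass, but its position is the edge, so the
      formula persists.\<close>
    have S: "cubic_sup a b c = cubic_atom a b c"
    proof (cases "?D > 1")
      case False
      then have "?D = 1" using D1 by simp
      then have "4 * a * (cubic_atom a b c - ?e) = 0" using atom by simp
      then show ?thesis using a False by (simp add: cubic_sup_def)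
    qed (simp add: cubic_sup_def)
    have "?D \<le> (- b)\<^sup>2" using a c D by simp
    then have "sqrt ?D \<le> - b" using bt t(1) by (intro real_le_lsqrt) auto
    then have "cubic_atom a b c \<ge> 0" using a by (simp add: cubic_atom_def)
    then have "max 0 (cubic_sup a b c) = cubic_atom a b c" using S by simp
    then show "cubic_mean a b c (max 0 (cubic_sup a b c)) = - (b + sqrt (b\<^sup>2 - 4 * a * c)) / (2 * a)"
      unfolding cubic_mean_def using D1 by (simp only: atom) (simp add: D)
  next
    assume bc: "c \<le> 0 \<or> c > 0 \<and> b > 2 * sqrt (a * c) - 1"
    have "cubic_sup a b c \<le> 0"
    proof (cases "?D > 1")
      case False
      have "4 * a * c \<le> (b + 1)\<^sup>2"
      proof (cases "c \<le> 0")
        case True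
        then have "4 * a * c \<le> 0" using a by (simp add: mult_le_0_iff)
        then show ?thesis using zero_le_power2[of "b + 1"] by linarith
      next
        case False
        then have "2 * sqrt (a * c) < b + 1" "0 \<le> 2 * sqrt (a * c)" using bc a by auto
        then have "(2 * sqrt (a * c))\<^sup>2 \<le> (b + 1)\<^sup>2" by (intro power_mono) auto
        then show ?thesis using False a by (simp add: power_mult_distrib)
      qed
      then show ?thesis using False e_sign by (simp add: cubic_sup_def)
    next
      case True
      have "0 \<le> b + sqrt ?D"
      proof (cases "c \<le> 0")
        case True
        then have "4 * a * c \<le> 0" using a by (simp add: mult_le_0_iff)
        then have "b\<^sup>2 \<le> ?D" using D by simp
        then have "\<bar>b\<bar> \<le> sqrt ?D" by (metis real_sqrt_abs real_sqrt_le_iff)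
        then show ?thesis by linarith
      next
        case False
        then have "0 \<le> sqrt (a * c)" "b > 2 * sqrt (a * c) - 1" "a * c > 0" using bc a by auto
        then have "b > -1" by linarith
        \<comment> \<open>For c > 0, \<Delta> > 1 gives |b| > 1, so b > -1 improves to b > 1 > 0 and
          the atom is negative.\<close>
        have "b\<^sup>2 > 1" using True D \<open>a * c > 0\<close> by simp
        then have "\<not> \<bar>b\<bar> \<le> 1" using abs_square_le_1[of b] by simp
        then have "b > 0" using \<open>b > -1\<close> by linarith
        then show ?thesis using True by simp
      qed
      then show ?thesis using True a by (simp add: cubic_sup_def cubic_atom_def divide_nonpos_pos)
    qed
    moreover have "4 * a * (0 - ?e) = (b + 1)\<^sup>2 - 4 * a * c" using e by simp
    ultimately show "cubic_mean a b c (max 0 (cubic_sup a b c)) = - (b + 1 + sqrt ((b + 1)\<^sup>2 - 4 * a * c)) / (2 * a)"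
      unfolding cubic_mean_def by (simp add: max_absorb1)
  }
qed

lemma cubic_mean_at_bot:
  assumes "a > 0"
  shows "filterlim (cubic_mean a b c) at_bot at_top"
  unfolding cubic_mean_def using assms by real_asymp

section \<open>Identification by analytic continuation\<close>

text \<open>The quadratic equation for the mean leaves two branches; the upper one exceeds \<open>B\<close> for large
  \<open>z\<close>. Since equality on a half-line suffices for analytic continuation, only large \<open>z\<close> matter.\<close>

lemma (in law_on_half_line) kernel_mean_eq_cubic_mean_eventually:
  assumes a: "a > 0" and inj: "inj_on kernel_mean {B<..}"
    and eq: "\<And>z. z > B \<Longrightarrow> kernel_mean z \<noteq> 0 \<Longrightarrow>
      z = a * (kernel_mean z)\<^sup>2 + (b + 1) * kernel_mean z + c"
  shows "\<forall>\<^sub>F z in at_top. kernel_mean z = cubic_mean a b c z"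
proof -
  let ?e = "cubic_edge a b c"
  \<comment> \<open>By injectivity the mean vanishes for at most one z; beyond it the quadratic
    equation is available.\<close>
  have "\<exists>z0. \<forall>z>max B z0. kernel_mean z \<noteq> 0"
  proof (cases "\<exists>z0>B. kernel_mean z0 = 0")
    case True
    then obtain z0 where z0: "z0 > B" "kernel_mean z0 = 0" by blast
    have "kernel_mean z \<noteq> 0" if "z > max B z0" for z
      using inj_onD[OF inj, of z z0] z0 that by auto
    then show ?thesis by blast
  qed auto
  then obtain z0 where z0: "\<And>z. z > max B z0 \<Longrightarrow> kernel_mean z \<noteq> 0" by blast
  \<comment> \<open>The threshold makes the square root exceed 2 a B + b + 1, so the upper root
    would lie above B.\<close>
  have "kernel_mean z = cubic_mean a b c z"
    if z: "z > max (max B z0) (?e + (2 * a * B + b + 1)\<^sup>2 / (4 * a))" for z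
  proof -
    define m where "m = kernel_mean z"
    define s where "s = sqrt (4 * a * (z - ?e))"
    have zB: "z > B" "z > max B z0" using z by auto
    have big: "4 * a * (z - ?e) > (2 * a * B + b + 1)\<^sup>2"
    proof -
      have "z - ?e > (2 * a * B + b + 1)\<^sup>2 / (4 * a)" using z by simp
      then show ?thesis using a by (simp add: field_simps)
    qed
    then have s2: "s\<^sup>2 = 4 * a * (z - ?e)"
      unfolding s_def using zero_le_power2[of "2 * a * B + b + 1"] by (intro real_sqrt_pow2) linarith
    have "2 * a * B + b + 1 < s" using big unfolding s_def by (rule real_less_rsqrt)
    moreover have "2 * a * m \<le> 2 * a * B" using kernel_mean_le[OF zB(1)] a by (simp add: m_def)
    ultimately have "2 * a * m + b + 1 \<noteq> s" by linarith
    moreover have "(2 * a * m + b + 1)\<^sup>2 = s\<^sup>2"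
    proof -
      have "z = a * m\<^sup>2 + (b + 1) * m + c" using eq[OF zB(1) z0[OF zB(2)]] by (simp add: m_def)
      moreover have "4 * a * ?e = 4 * a * c - (b + 1)\<^sup>2" using a by (simp add: cubic_edge_def right_diff_distrib)
      ultimately show ?thesis unfolding s2 by algebra
    qed
    ultimately have "2 * a * m + b + 1 = - s" by (simp add: power2_eq_iff)
    then have "m = - (b + 1 + s) / (2 * a)" using a by (simp add: field_simps)
    then show ?thesis by (simp add: m_def s_def cubic_mean_def)
  qed
  then show ?thesis using eventually_gt_at_top by (rule eventually_mono[rotated])
qed

text \<open>The identity theorem on the slit plane, starting from large real z, where G = 1/(z - m).
  The product form avoids dividing by a denominator whose zeros would first have to be excluded. The
  free bound B' allows a use before the edge is known to lie below B.\<close>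

lemma (in law_on_half_line) cauchy_transform_eq_cubic_G:
  assumes a: "a > 0" and B: "cubic_edge a b c \<le> B'" "B \<le> B'"
    and ev: "\<forall>\<^sub>F z in at_top. kernel_mean z = cubic_mean a b c z"
    and z: "z \<in> slit_plane B'"
  shows "cauchy_transform M z * ((cubic_sqrt a b c z + 1)\<^sup>2 - of_real (cubic_disc a b c)) = 4 * of_real a"
proof -
  let ?f = "\<lambda>z. cauchy_transform M z * ((cubic_sqrt a b c z + 1)\<^sup>2 - of_real (cubic_disc a b c)) - 4 * of_real a"
  obtain Z where Z: "\<And>z. z \<ge> Z \<Longrightarrow> kernel_mean z = cubic_mean a b c z"
    using ev by (auto simp: eventually_at_top_linorder)
  define r where "r = max B' Z + 1"
  let ?U = "complex_of_real ` {max B' Z<..}"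
  have "?f z = 0"
  proof (rule analytic_continuation[OF _ open_slit_plane connected_slit_plane, of ?f B' ?U "of_real r"])
    have "slit_plane B' \<subseteq> slit_plane B" using B by (auto simp: slit_plane_def)
    then have "cauchy_transform M holomorphic_on slit_plane B'"
      using holomorphic_cauchy_transform by (rule_tac holomorphic_on_subset)
    then show "?f holomorphic_on slit_plane B'"
      by (intro holomorphic_intros holomorphic_cubic_sqrt a B)
    show "?U \<subseteq> slit_plane B'" by (auto simp: slit_plane_def)
    show "complex_of_real r \<in> slit_plane B'" by (simp add: slit_plane_def r_def)
    show "complex_of_real r islimpt ?U"
    proof (rule islimpt_isCont_image)
      have "r islimpt interior {max B' Z<..}" 
        by (simp add: r_def interior_open open_imp_islimpt)
      then show "r islimpt {max B' Z<..}" by (simp add: interior_open)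
      show "\<forall>\<^sub>F y in at r. complex_of_real y \<noteq> complex_of_real r"
        by (simp add: eventually_at_filter)
    qed (intro continuous_intros)
    show "z \<in> slit_plane B'" by (rule z)
    fix w assume "w \<in> ?U"
    then obtain x where x: "x > B'" "x \<ge> Z" "w = of_real x" by auto
    then have xB: "x > B" "cubic_edge a b c \<le> x" using B by auto
    have "real_cauchy x * (x - cubic_mean a b c x) = 1"
      using real_cauchy_pos[OF xB(1)] unfolding Z[OF x(2), symmetric] by (simp add: kernel_mean_def)
    then have "real_cauchy x * (4 * a * (x - cubic_mean a b c x)) = 4 * a" by algebra
    from arg_cong[OF this, of complex_of_real]
    show "?f w = 0"
      unfolding x(3) cauchy_transform_of_real cubic_G_denom_of_real[OF a xB(2)] by simp
  qed
  then show ?thesis by simp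
qed

text \<open>At a zero of the quadratic the formula for G is asserted as a limit. For \<Delta> < 0
  the written position of the atom is a default value, and its mass is zero.\<close>

theorem mainTheorem3:
  fixes \<nu> :: "real measure" and a b c :: real
  assumes "a > 0"
    and "real_distribution \<nu>"
    and "nondegenerate \<nu>"
    and "bdd_above (msupp \<nu>)"
    and "\<forall>m\<in>domain_of_means \<nu>. pseudo_variance \<nu> m = m * (a * m\<^sup>2 + b * m + c)"
  shows "(\<forall>z. Im z > 0 \<longrightarrow>
            (of_real c + of_real b * z + of_real a * z\<^sup>2 \<noteq> 0 \<longrightarrow>
               cauchy_transform \<nu> z = cubic_cauchy a b c z) \<and>
            (of_real c + of_real b * z + of_real a * z\<^sup>2 = 0 \<longrightarrow>
               (cubic_cauchy a b c \<longlongrightarrow> cauchy_transform \<nu> z) (at z)))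
       \<and> (\<forall>A\<in>sets borel.
            emeasure \<nu> A =
              emeasure (density lborel (\<lambda>x. ennreal (cubic_density a b c x))) A
              + ennreal (cubic_atom_mass a b c)
                * emeasure (return borel (- (b + sqrt (b\<^sup>2 - 4 * a * c)) / (2 * a))) A)
       \<and> (c > 0 \<and> - sqrt (1 + 4 * a * c) \<le> b \<and> b \<le> 2 * sqrt (a * c) - 1 \<longrightarrow>
            domain_of_means \<nu> = {..<- (1 + b) / (2 * a)})
       \<and> (c > 0 \<and> b \<le> - sqrt (1 + 4 * a * c) \<longrightarrow>
            domain_of_means \<nu> = {..<- (b + sqrt (b\<^sup>2 - 4 * a * c)) / (2 * a)})
       \<and> (c \<le> 0 \<or> c > 0 \<and> b > 2 * sqrt (a * c) - 1 \<longrightarrow>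
            domain_of_means \<nu> = {..<- (b + 1 + sqrt ((b + 1)\<^sup>2 - 4 * a * c)) / (2 * a)})
       \<and> freely_infinitely_divisible \<nu>
       \<and> \<not> integrable \<nu> (\<lambda>x. x)"
proof -
  note a = assms(1)
  define B where "B = csk_B \<nu>"
  interpret real_distribution \<nu> by (rule assms(2))
  interpret L: law_on_half_line \<nu> B
    by unfold_locales (simp add: B_def AE_le_csk_B[OF assms(4)])
  have B0: "B \<ge> 0" by (simp add: B_def csk_B_def)
  have params: "csk_params \<nu> = (\<lambda>z. 1 / z) ` {B<..}" by (simp add: csk_params_eq B_def)
  have mean: "csk_mean \<nu> (1 / z) = L.kernel_mean z" if "z > B" for z
    using that B0 by (intro L.csk_mean_eq_kernel_mean) auto
  have inj: "inj_on L.kernel_mean {B<..}" by (rule L.inj_on_kernel_mean[OF assms(3)])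
  have inj_csk: "inj_on (csk_mean \<nu>) (csk_params \<nu>)"
  proof (rule inj_onI)
    fix s t assume st: "s \<in> csk_params \<nu>" "t \<in> csk_params \<nu>" "csk_mean \<nu> s = csk_mean \<nu> t"
    then obtain x y where xy: "x > B" "y > B" "s = 1 / x" "t = 1 / y" unfolding params by auto
    then have "L.kernel_mean x = L.kernel_mean y" using st(3) mean by simp
    then have "x = y" using inj_onD[OF inj] xy by auto
    then show "s = t" using xy by simp
  qed
  have domain: "domain_of_means \<nu> = L.kernel_mean ` {B<..}"
    unfolding domain_of_means_def params image_image using mean by (intro image_cong) auto
  have quadratic: "z = a * (L.kernel_mean z)\<^sup>2 + (b + 1) * L.kernel_mean z + c"
    if z: "z > B" "L.kernel_mean z \<noteq> 0" for z
  proof -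
    have "csk_psi \<nu> (L.kernel_mean z) = 1 / z"
      unfolding csk_psi_def mean[OF z(1), symmetric]
      by (rule the_inv_into_f_f[OF inj_csk]) (use z in \<open>auto simp: params\<close>)
    then have "pseudo_variance \<nu> (L.kernel_mean z) = L.kernel_mean z * (z - L.kernel_mean z)"
      by (simp add: pseudo_variance_def)
    moreover have "L.kernel_mean z \<in> domain_of_means \<nu>" using z domain by auto
    ultimately have "L.kernel_mean z * (z - L.kernel_mean z)
        = L.kernel_mean z * (a * (L.kernel_mean z)\<^sup>2 + b * L.kernel_mean z + c)"
      using assms(5) by metis
    \<comment> \<open>At mean 0 the hypothesis reads 0 = 0, so the factor is cancelled only for a
      nonzero mean.\<close>
    then have "z - L.kernel_mean z = a * (L.kernel_mean z)\<^sup>2 + b * L.kernel_mean z + c"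
      using z(2) by (simp only: mult_cancel_left simp_thms)
    then show ?thesis by (simp add: algebra_simps)
  qed
  have ev: "\<forall>\<^sub>F z in at_top. L.kernel_mean z = cubic_mean a b c z"
    by (rule L.kernel_mean_eq_cubic_mean_eventually[OF a inj quadratic])
  have G: "cauchy_transform \<nu> z = cubic_G a b c z" if "Im z > 0" for z
  proof -
    \<comment> \<open>The relation between B and the edge is still unknown, so the plane is slit up
      to the larger of the two.\<close>
    have "cauchy_transform \<nu> z * ((cubic_sqrt a b c z + 1)\<^sup>2 - of_real (cubic_disc a b c)) = 4 * of_real a"
      using that by (intro L.cauchy_transform_eq_cubic_G[OF a _ _ ev, of "max B (cubic_edge a b c)"])
        (auto simp: slit_plane_def)
    moreover have "4 * complex_of_real a \<noteq> 0" using a by simp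
    \<comment> \<open>The denominator is nonzero because the product is 4 a.\<close>
    ultimately show ?thesis unfolding cubic_G_def by (metis mult_eq_0_iff nonzero_eq_divide_eq)
  qed
  have law: "\<nu> = cubic_law a b c"
    using G by (intro cauchy_transform_unique assms(2) real_distribution_cubic_law a)
      (simp add: cauchy_transform_cubic_law[OF a])
  have B_eq: "B = max 0 (cubic_sup a b c)"
    using Sup_msupp_cubic_law[OF a, of b c] assms(4) unfolding law[symmetric]
    by (simp add: B_def csk_B_def)
  then have eB: "cubic_edge a b c \<le> B" using cubic_edge_le_sup[OF a, of b c] by simp
  \<comment> \<open>Now that the law is identified and the edge lies below B, a second continuation
    extends the formula from large z to all z > B.\<close>
  have mean_cubic: "L.kernel_mean z = cubic_mean a b c z" if z: "z > B" for z
  proof -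
    have "complex_of_real (L.real_cauchy z * (4 * a * (z - cubic_mean a b c z))) = complex_of_real (4 * a)"
      using L.cauchy_transform_eq_cubic_G[OF a eB order_refl ev, of "of_real z"] z eB
      unfolding L.cauchy_transform_of_real by (simp add: cubic_G_denom_of_real[OF a] slit_plane_def)
    then have "L.real_cauchy z * (4 * a * (z - cubic_mean a b c z)) = 4 * a" by (simp only: of_real_eq_iff)
    then have "L.real_cauchy z * (z - cubic_mean a b c z) = 1" using a by simp
    then show ?thesis
      using L.real_cauchy_pos[OF z] by (simp add: L.kernel_mean_def field_simps)
  qed
  have domain': "domain_of_means \<nu> = {..<cubic_mean a b c (max 0 (cubic_sup a b c))}"
  proof -
    have "domain_of_means \<nu> = cubic_mean a b c ` {B<..}"
      unfolding domain using mean_cubic by (intro image_cong) auto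
    also have "\<dots> = {..<cubic_mean a b c B}" by (rule image_cubic_mean[OF a eB])
    finally show ?thesis by (simp only: B_eq)
  qed
  \<comment> \<open>G is continuous and the quadratic has only finitely many zeros, so the formula
    holds in a punctured neighbourhood of each point.\<close>
  have cauchy: "cubic_cauchy a b c \<midarrow>z\<rightarrow> cauchy_transform \<nu> z" if z: "Im z > 0" for z
  proof (rule Lim_transform_eventually)
    have "cauchy_transform \<nu> holomorphic_on slit_plane B" by (rule L.holomorphic_cauchy_transform)
    then have "isCont (cauchy_transform \<nu>) z"
      using z open_slit_plane by (intro continuous_on_interior[OF holomorphic_on_imp_continuous_on])
        (auto simp: interior_open slit_plane_def[symmetric], simp add: slit_plane_def)
    then show "cauchy_transform \<nu> \<midarrow>z\<rightarrow> cauchy_transform \<nu> z" by (simp add: isCont_def)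
    define p where "p = [:of_real c, of_real b, complex_of_real a:]"
    have p: "p \<noteq> 0" using a by (simp add: p_def)
    have p_eq: "poly p w = of_real c + of_real b * w + of_real a * w\<^sup>2" for w
      by (simp add: p_def power2_eq_square algebra_simps)
    have "\<forall>\<^sub>F w in at z. poly p w \<noteq> 0"
      using poly_roots_finite[OF p] islimpt_finite[of "{w. poly p w = 0}" z] by (simp add: islimpt_iff_eventually)
    moreover have "\<forall>\<^sub>F w in at z. Im w > 0"
      using z eventually_at_in_open'[OF open_halfspace_Im_gt, of z 0] by simp
    ultimately show "\<forall>\<^sub>F w in at z. cauchy_transform \<nu> w = cubic_cauchy a b c w"
      by eventually_elim (simp add: G cubic_cauchy_eq_cubic_G[OF a] p_eq)
  qed
  have no_mean: "\<not> integrable \<nu> (\<lambda>x. x)"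
  proof
    assume "integrable \<nu> (\<lambda>x. x)"
    then obtain C where C: "\<And>z. z > B \<Longrightarrow> z \<ge> 2 * B \<Longrightarrow> z \<ge> C \<Longrightarrow> L.kernel_mean z \<ge> - C"
      using L.kernel_mean_bounded_below by blast
    have "\<forall>\<^sub>F z in at_top. cubic_mean a b c z < - C"
      using cubic_mean_at_bot[OF a] by (simp add: filterlim_at_bot_dense)
    with eventually_gt_at_top[of B] eventually_ge_at_top[of "2 * B"] eventually_ge_at_top[of C]
    have "\<forall>\<^sub>F z in at_top. z > B \<and> z \<ge> 2 * B \<and> z \<ge> C \<and> cubic_mean a b c z < - C"
      by eventually_elim simp
    then obtain z where "z > B" "z \<ge> 2 * B" "z \<ge> C" "cubic_mean a b c z < - C"
      using eventually_happens'[OF trivial_limit_at_top_linorder] by blast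
    then show False using C[of z] mean_cubic[of z] by simp
  qed
  show ?thesis
  proof (intro conjI allI ballI impI)
    show "cauchy_transform \<nu> z = cubic_cauchy a b c z"
      if "Im z > 0" "of_real c + of_real b * z + of_real a * z\<^sup>2 \<noteq> 0" for z
      using that by (simp add: G cubic_cauchy_eq_cubic_G[OF a])
    show "emeasure \<nu> A = emeasure (density lborel (\<lambda>x. ennreal (cubic_density a b c x))) A
        + ennreal (cubic_atom_mass a b c) * emeasure (return borel (- (b + sqrt (b\<^sup>2 - 4 * a * c)) / (2 * a))) A"
      if "A \<in> sets borel" for A
      using emeasure_cubic_law[OF a that, of b c] unfolding law[symmetric] cubic_atom_def cubic_disc_def .
    show "freely_infinitely_divisible \<nu>"
      unfolding law by (rule freely_infinitely_divisible_cubic_law[OF a])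
  qed (use cauchy domain' upper_mean_cases[OF a, of c b] no_mean in auto)
qed

end
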